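(* Let $s$ be a fixed quadratic section. Two special $2$-fold coverings $\varphi,\varphi'\in\mathcal{E}(q)$ are $s$-related if and only if the Arf invariants of the quadratic forms $\omega_\varphi=\tilde\varphi\circ s$ and $\omega_{\varphi'}=\tilde\varphi'\circ s$ are equal, explicitly $$\sum_{j=1}^g\tilde\varphi(s(\sigma_{2j-1}))\,\tilde\varphi(s(\sigma_{2j}))=\sum_{j=1}^g\tilde\varphi'(s(\sigma_{2j-1}))\,\tilde\varphi'(s(\sigma_{2j}))\quad\text{in }\mathbb{Z}_2.$$
   Context: Setting. $g\ge1$, $F_g$ is the closed oriented surface of genus $g$, and $S^1\hookrightarrow P\xrightarrow{p}F_g$ is a principal $S^1$-bundle with even Chern class $q$. $\pi_1(F_g)=\langle x_1,\dots,x_{2g}\mid \prod_{j=1}^g[x_{2j-1},x_{2j}]\rangle$ is the standard presentation. $u_0\in\pi_1(P)$ is the image of a generator of $\pi_1(S^1)$ (the fiber), and $u_i\in\pi_1(P)$, $1\le i\le 2g$, are chosen with $p_\sharp(u_i)=x_i$, so that $\pi_1(P)=\langle u_0,u_1,\dots,u_{2g}\mid [u_i,u_0]\ (1\le i\le 2g),\ \prod_{\ell=1}^g[u_{2\ell-1},u_{2\ell}]\,u_0^{q}\rangle$. Special coverings. $\mathcal{E}(q)$ is the set of homomorphisms $\varphi\colon\pi_1(P)\to\mathbb{Z}_2$ with $\varphi(u_0)=1$ (the nontrivial element of $\mathbb{Z}_2$); these are the monodromies of the special $2$-fold coverings of $P$. Let $h_P\colon\pi_1(P)\to H_1(P;\mathbb{Z}_2)$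 and $h_{F_g}\colon\pi_1(F_g)\to H_1(F_g;\mathbb{Z}_2)$ be the mod $2$ Hurewicz maps. Each $\varphi\in\mathcal{E}(q)$ factors uniquely as $\varphi=\tilde\varphi\circ h_P$ with $\tilde\varphi\colon H_1(P;\mathbb{Z}_2)\to\mathbb{Z}_2$ linear. Quadratic section. Put $\sigma_i=h_{F_g}(x_i)$ (a symplectic basis of $H_1(F_g;\mathbb{Z}_2)$ for the mod $2$ intersection product "$\cdot$", with $\sigma_{2i-1}\cdot\sigma_{2i}=1$ and all other products of distinct basis elements zero) and $\nu_i=h_P(u_i)$, $0\le i\le 2g$ (a basis of $H_1(P;\mathbb{Z}_2)$). Given $r_1,\dots,r_{2g}\in\mathbb{Z}_2$, the quadratic section $s$ is the unique map $s\colon H_1(F_g;\mathbb{Z}_2)\to H_1(P;\mathbb{Z}_2)$ with $s(\sigma_i)=\nu_i+r_i\nu_0$ for $1\le i\le 2g$ and $s(a+b)=s(a)+s(b)+(a\cdot b)\nu_0$ for all $a,b$. For a symplectic automorphism $f$ of $(H_1(F_g;\mathbb{Z}_2),\cdot)$, $f_s$ is the linear automorphism of $H_1(P;\mathbb{Z}_2)$ with $f_s(s(\sigma_i))=s(f(\sigma_i))$ for all $1\le i\le 2g$ and $f_s(\nu_0)=\nu_0$. $\varphi,\varphi'$ are $s$-related if there is a symplectic automorphism $f$ of $(H_1(F_g;\mathbb{Z}_2),\cdot)$ with $\tilde\varphi=\tilde\varphi'\circ f_s$ (equivalently $\tilde\varphi\circ s=\tilde\varphi'\circ s\circ f$). The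 map $\omega_\varphi=\tilde\varphi\circ s$ is a quadratic form: $\omega_\varphi(a+b)=\omega_\varphi(a)+\omega_\varphi(b)+a\cdot b$. The Arf invariant of a quadratic form $\omega$ is $\alpha(\omega)=\sum_{j=1}^g\omega(\sigma_{2j-1})\omega(\sigma_{2j})$. *)

theory Defs
  imports "HOL-Complex_Analysis.Complex_Analysis" "HOL-Homology.Homology" "HOL-Library.Z2"
begin

section \<open>Fundamental groups\<close>

definition loop_class :: "'a::topological_space set \<Rightarrow> (real \<Rightarrow> 'a) \<Rightarrow> (real \<Rightarrow> 'a) set" where
  "loop_class S \<gamma> = Collect (homotopic_paths S \<gamma>)"

definition fundamental_group :: "'a::topological_space set \<Rightarrow> 'a \<Rightarrow> (real \<Rightarrow> 'a) set monoid" where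
  "fundamental_group S a =
     \<lparr> carrier = loop_class S ` {\<gamma>. path \<gamma> \<and> path_image \<gamma> \<subseteq> S \<and> pathstart \<gamma> = a \<and> pathfinish \<gamma> = a},
       mult = (\<lambda>C D. \<Union>\<gamma>\<in>C. \<Union>\<delta>\<in>D. loop_class S (\<gamma> +++ \<delta>)),
       one = loop_class S (\<lambda>_. a) \<rparr>"

definition fundamental_map ::
  "'b::topological_space set \<Rightarrow> ('a \<Rightarrow> 'b) \<Rightarrow> (real \<Rightarrow> 'a) set \<Rightarrow> (real \<Rightarrow> 'b) set" where
  "fundamental_map T f C = (\<Union>\<gamma>\<in>C. loop_class T (f \<circ> \<gamma>))"


section \<open>Group presentations\<close>

text \<open>The letter \<open>(i, True)\<close> stands for the \<open>i\<close>-th generator and \<open>(i, False)\<close> for its inverse.\<close>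

type_synonym group_word = "(nat \<times> bool) list"

inductive word_eq :: "nat set \<Rightarrow> group_word set \<Rightarrow> group_word \<Rightarrow> group_word \<Rightarrow> bool"
  for I :: "nat set" and R :: "group_word set" where
  refl: "word_eq I R v v"
| sym: "word_eq I R v w \<Longrightarrow> word_eq I R w v"
| trans: "word_eq I R v w \<Longrightarrow> word_eq I R w w' \<Longrightarrow> word_eq I R v w'"
| congr: "word_eq I R v w \<Longrightarrow> word_eq I R (a @ v @ b) (a @ w @ b)"
| cancel: "i \<in> I \<Longrightarrow> word_eq I R [(i, s), (i, \<not> s)] []"
| relator: "r \<in> R \<Longrightarrow> word_eq I R r []"

fun word_value :: "('a, 'm) monoid_scheme \<Rightarrow> (nat \<Rightarrow> 'a) \<Rightarrow> group_word \<Rightarrow> 'a" where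
  "word_value G u [] = \<one>\<^bsub>G\<^esub>"
| "word_value G u ((i, s) # w) = (if s then u i else inv\<^bsub>G\<^esub> (u i)) \<otimes>\<^bsub>G\<^esub> word_value G u w"

text \<open>\<open>presented_by G I u R\<close>: the group \<open>G\<close> is presented by the generators \<open>u i\<close>, \<open>i \<in> I\<close>, and
  the relators \<open>R\<close>.\<close>

definition presented_by ::
  "('a, 'm) monoid_scheme \<Rightarrow> nat set \<Rightarrow> (nat \<Rightarrow> 'a) \<Rightarrow> group_word set \<Rightarrow> bool" where
  "presented_by G I u R \<longleftrightarrow>
     u ` I \<subseteq> carrier G \<and> generate G (u ` I) = carrier G \<and>
     (\<forall>w. fst ` set w \<subseteq> I \<longrightarrow> (word_value G u w = \<one>\<^bsub>G\<^esub> \<longleftrightarrow> word_eq I R w []))"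

definition comm_word :: "nat \<Rightarrow> nat \<Rightarrow> group_word" where
  "comm_word i j = [(i, True), (j, True), (i, False), (j, False)]"

definition surface_word :: "nat \<Rightarrow> group_word" where
  "surface_word g = concat (map (\<lambda>j. comm_word (2 * j - 1) (2 * j)) [1..<g + 1])"

definition power_word :: "nat \<Rightarrow> int \<Rightarrow> group_word" where
  "power_word i q = replicate (nat \<bar>q\<bar>) (i, 0 \<le> q)"

definition surface_relators :: "nat \<Rightarrow> group_word set" where
  "surface_relators g = {surface_word g}"

definition bundle_relators :: "nat \<Rightarrow> int \<Rightarrow> group_word set" where
  "bundle_relators g q =
     insert (surface_word g @ power_word 0 q) ((\<lambda>i. comm_word i 0) ` {1..2 * g})"


section \<open>Closed oriented surfaces and principal circle bundles\<close>

text \<open>The closed oriented surface of genus \<open>g \<ge> 1\<close> in its normal form: the quotient of the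
  closed disc, regarded as a polygon with \<open>4 g\<close> sides, by the boundary word
  \<open>a\<^sub>1 b\<^sub>1 a\<^sub>1\<^sup>-\<^sup>1 b\<^sub>1\<^sup>-\<^sup>1 \<dots> a\<^sub>g b\<^sub>g a\<^sub>g\<^sup>-\<^sup>1 b\<^sub>g\<^sup>-\<^sup>1\<close> read counterclockwise.
  The quotient map \<open>e\<close> transports the standard orientation of the disc to the surface.\<close>

definition polygon_side :: "nat \<Rightarrow> nat \<Rightarrow> real \<Rightarrow> complex" where
  "polygon_side g k t = cis (2 * pi * (real k + t) / real (4 * g))"

definition side_pairing :: "nat \<Rightarrow> (complex \<times> complex) set" where
  "side_pairing g =
     {(polygon_side g (4 * j + m) t, polygon_side g (4 * j + m + 2) (1 - t)) | j m t.
        j < g \<and> m < 2 \<and> t \<in> {0..1}}"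

definition oriented_surface :: "nat \<Rightarrow> 'b::topological_space set \<Rightarrow> (complex \<Rightarrow> 'b) \<Rightarrow> bool" where
  "oriented_surface g F e \<longleftrightarrow>
     quotient_map (top_of_set (cball 0 1)) (top_of_set F) e \<and>
     (\<forall>z\<in>cball 0 1. \<forall>w\<in>cball 0 1. e z = e w \<longleftrightarrow> (z, w) \<in> (side_pairing g \<union> (side_pairing g)\<inverse>)\<^sup>*)"

abbreviation unit_circle :: "complex set" where
  "unit_circle \<equiv> sphere 0 1"

definition principal_circle_bundle ::
  "(complex \<Rightarrow> 'a \<Rightarrow> 'a) \<Rightarrow> 'a::topological_space set \<Rightarrow> ('a \<Rightarrow> 'b) \<Rightarrow> 'b::topological_space set \<Rightarrow> bool" where
  "principal_circle_bundle act P p F \<longleftrightarrow>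
     continuous_on (unit_circle \<times> P) (\<lambda>(z, y). act z y) \<and>
     (\<forall>z\<in>unit_circle. \<forall>y\<in>P. act z y \<in> P) \<and>
     (\<forall>y\<in>P. act 1 y = y) \<and>
     (\<forall>z\<in>unit_circle. \<forall>w\<in>unit_circle. \<forall>y\<in>P. act (z * w) y = act z (act w y)) \<and>
     continuous_on P p \<and> p ` P = F \<and>
     (\<forall>x\<in>F. \<exists>U \<psi> \<psi>'.
        openin (top_of_set F) U \<and> x \<in> U \<and>
        homeomorphism (U \<times> unit_circle) {y \<in> P. p y \<in> U} \<psi> \<psi>' \<and>
        (\<forall>x'\<in>U. \<forall>z\<in>unit_circle.
           p (\<psi> (x', z)) = x' \<and> (\<forall>w\<in>unit_circle. act w (\<psi> (x', z)) = \<psi> (x', w * z))))"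

text \<open>The Chern number is the obstruction to extending a section over the 2-cell \<open>e\<close>: the section
  \<open>s\<close> over the 1-skeleton and the lift \<open>\<tau>\<close> of the whole 2-cell differ along the boundary of the
  cell by a map \<open>c\<close> from the circle to itself, and the Chern number is the degree of \<open>c\<close>.\<close>

definition chern_number ::
  "(complex \<Rightarrow> 'a \<Rightarrow> 'a) \<Rightarrow> 'a::topological_space set \<Rightarrow> ('a \<Rightarrow> 'b) \<Rightarrow> (complex \<Rightarrow> 'b::topological_space) \<Rightarrow> int \<Rightarrow> bool" where
  "chern_number act P p e q \<longleftrightarrow>
     (\<exists>\<tau> s c.
        continuous_on (cball 0 1) \<tau> \<and> \<tau> ` cball 0 1 \<subseteq> P \<and> (\<forall>z\<in>cball 0 1. p (\<tau> z) = e z) \<and>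
        continuous_on (e ` unit_circle) s \<and> s ` e ` unit_circle \<subseteq> P \<and>
          (\<forall>x\<in>e ` unit_circle. p (s x) = x) \<and>
        continuous_on unit_circle c \<and> c ` unit_circle \<subseteq> unit_circle \<and>
        (\<forall>z\<in>unit_circle. s (e z) = act (c z) (\<tau> z)) \<and>
        winding_number (\<lambda>t. c (cis (2 * pi * t))) 0 = of_int q)"

definition fiber_class ::
  "(complex \<Rightarrow> 'a \<Rightarrow> 'a) \<Rightarrow> 'a::topological_space set \<Rightarrow> 'a \<Rightarrow> (real \<Rightarrow> 'a) set \<Rightarrow> bool" where
  "fiber_class act P y C \<longleftrightarrow>
     (\<exists>z \<in> carrier (fundamental_group unit_circle 1).
        generate (fundamental_group unit_circle 1) {z} = carrier (fundamental_group unit_circle 1) \<and>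
        C = fundamental_map P (\<lambda>w. act w y) z)"


section \<open>Singular homology with coefficients in the field with two elements\<close>

text \<open>The chain groups with mod 2 coefficients are the integral ones modulo \<open>2\<close>. Hence a mod 2
  cycle is represented by an integral chain whose boundary is divisible by \<open>2\<close>, and such a chain
  represents a boundary iff it is an integral boundary up to a chain divisible by \<open>2\<close>.\<close>

definition mod2_cycles :: "nat \<Rightarrow> 'a topology \<Rightarrow> 'a chain set" where
  "mod2_cycles n X =
     {c. singular_chain n X c \<and>
         (\<exists>d. singular_chain (n - 1) X d \<and> chain_boundary n c = frag_cmul 2 d)}"

definition mod2_boundaries :: "nat \<Rightarrow> 'a topology \<Rightarrow> 'a chain set" where
  "mod2_boundaries n X =
     {chain_boundary (Suc n) d + frag_cmul 2 c | d c.
         singular_chain (Suc n) X d \<and> singular_chain n X c}"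

definition mod2_cycle_group :: "nat \<Rightarrow> 'a topology \<Rightarrow> 'a chain monoid" where
  "mod2_cycle_group n X = subgroup_generated (chain_group n X) (mod2_cycles n X)"

definition mod2_homology_group :: "nat \<Rightarrow> 'a topology \<Rightarrow> 'a chain set monoid" where
  "mod2_homology_group n X = mod2_cycle_group n X Mod mod2_boundaries n X"

abbreviation H1 :: "'a::topological_space set \<Rightarrow> 'a chain set monoid" where
  "H1 S \<equiv> mod2_homology_group 1 (top_of_set S)"

definition path_simplex :: "(real \<Rightarrow> 'a) \<Rightarrow> (nat \<Rightarrow> real) \<Rightarrow> 'a" where
  "path_simplex \<gamma> = restrict (\<lambda>x. \<gamma> (x 1)) (standard_simplex 1)"

text \<open>All loops in a class \<open>C\<close> of the fundamental group yield the same homology class.\<close>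

definition hurewicz :: "'a::topological_space set \<Rightarrow> (real \<Rightarrow> 'a) set \<Rightarrow> 'a chain set" where
  "hurewicz S C =
     the_elem ((\<lambda>\<gamma>. mod2_boundaries 1 (top_of_set S)
                       #>\<^bsub>mod2_cycle_group 1 (top_of_set S)\<^esub> frag_of (path_simplex \<gamma>)) ` C)"


section \<open>Vector spaces over the field with two elements\<close>

text \<open>Such a vector space is an abelian group of exponent \<open>2\<close> (written multiplicatively), and
  its linear maps are the group homomorphisms.\<close>

definition Z2 :: "bit monoid" where
  "Z2 = \<lparr> carrier = UNIV, mult = (+), one = 0 \<rparr>"

definition scale :: "('v, 'm) monoid_scheme \<Rightarrow> bit \<Rightarrow> 'v \<Rightarrow> 'v" where
  "scale V r v = (if r = 1 then v else \<one>\<^bsub>V\<^esub>)"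

text \<open>\<open>d\<close> is the bilinear alternating form for which \<open>\<sigma>\<^sub>1, \<dots>, \<sigma>\<^sub>2\<^sub>g\<close> is a symplectic basis.\<close>

definition intersection_product ::
  "('v, 'm) monoid_scheme \<Rightarrow> nat \<Rightarrow> (nat \<Rightarrow> 'v) \<Rightarrow> ('v \<Rightarrow> 'v \<Rightarrow> bit) \<Rightarrow> bool" where
  "intersection_product V g \<sigma> d \<longleftrightarrow>
     (\<forall>a\<in>carrier V. \<forall>b\<in>carrier V. \<forall>c\<in>carrier V.
        d (a \<otimes>\<^bsub>V\<^esub> b) c = d a c + d b c \<and> d c (a \<otimes>\<^bsub>V\<^esub> b) = d c a + d c b) \<and>
     (\<forall>a\<in>carrier V. d a a = 0) \<and>
     (\<forall>i\<in>{1..2 * g}. \<forall>j\<in>{1..2 * g}. i \<noteq> j \<longrightarrow>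
        d (\<sigma> i) (\<sigma> j) = (if \<exists>k\<in>{1..g}. {i, j} = {2 * k - 1, 2 * k} then 1 else 0))"

definition symplectic_auts :: "('v, 'm) monoid_scheme \<Rightarrow> ('v \<Rightarrow> 'v \<Rightarrow> bit) \<Rightarrow> ('v \<Rightarrow> 'v) set" where
  "symplectic_auts V d =
     {f \<in> iso V V. \<forall>a\<in>carrier V. \<forall>b\<in>carrier V. d (f a) (f b) = d a b}"

definition arf_invariant :: "nat \<Rightarrow> (nat \<Rightarrow> 'v) \<Rightarrow> ('v \<Rightarrow> bit) \<Rightarrow> bit" where
  "arf_invariant g \<sigma> \<omega> = (\<Sum>j = 1..g. \<omega> (\<sigma> (2 * j - 1)) * \<omega> (\<sigma> (2 * j)))"


section \<open>Special coverings and quadratic sections\<close>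

text \<open>The special coverings are given by their monodromies.\<close>

definition special_coverings ::
  "'a::topological_space set \<Rightarrow> 'a \<Rightarrow> (real \<Rightarrow> 'a) set \<Rightarrow> ((real \<Rightarrow> 'a) set \<Rightarrow> bit) set" where
  "special_coverings P y u0 = {\<phi> \<in> hom (fundamental_group P y) Z2. \<phi> u0 = 1}"

definition homology_functional ::
  "'a::topological_space set \<Rightarrow> 'a \<Rightarrow> ((real \<Rightarrow> 'a) set \<Rightarrow> bit) \<Rightarrow> 'a chain set \<Rightarrow> bit" where
  "homology_functional P y \<phi> =
     (THE \<psi>. \<psi> \<in> hom (H1 P) Z2 \<and> \<psi> \<in> extensional (carrier (H1 P)) \<and>
             (\<forall>C\<in>carrier (fundamental_group P y). \<psi> (hurewicz P C) = \<phi> C))"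

definition quadratic_section ::
  "('v, 'm) monoid_scheme \<Rightarrow> ('w, 'n) monoid_scheme \<Rightarrow> nat \<Rightarrow> ('v \<Rightarrow> 'v \<Rightarrow> bit) \<Rightarrow>
   (nat \<Rightarrow> 'v) \<Rightarrow> (nat \<Rightarrow> 'w) \<Rightarrow> (nat \<Rightarrow> bit) \<Rightarrow> ('v \<Rightarrow> 'w) \<Rightarrow> bool" where
  "quadratic_section V W g d \<sigma> \<nu> r s \<longleftrightarrow>
     s \<in> carrier V \<rightarrow> carrier W \<and>
     (\<forall>i\<in>{1..2 * g}. s (\<sigma> i) = \<nu> i \<otimes>\<^bsub>W\<^esub> scale W (r i) (\<nu> 0)) \<and>
     (\<forall>a\<in>carrier V. \<forall>b\<in>carrier V.
        s (a \<otimes>\<^bsub>V\<^esub> b) = s a \<otimes>\<^bsub>W\<^esub> s b \<otimes>\<^bsub>W\<^esub> scale W (d a b) (\<nu> 0))"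

definition section_lift ::
  "('w, 'n) monoid_scheme \<Rightarrow> nat \<Rightarrow> (nat \<Rightarrow> 'v) \<Rightarrow> 'w \<Rightarrow> ('v \<Rightarrow> 'w) \<Rightarrow> ('v \<Rightarrow> 'v) \<Rightarrow> 'w \<Rightarrow> 'w" where
  "section_lift W g \<sigma> \<nu>0 s f =
     (THE k. k \<in> iso W W \<and> k \<in> extensional (carrier W) \<and>
             (\<forall>i\<in>{1..2 * g}. k (s (\<sigma> i)) = s (f (\<sigma> i))) \<and> k \<nu>0 = \<nu>0)"

definition s_related ::
  "('v, 'm) monoid_scheme \<Rightarrow> ('w, 'n) monoid_scheme \<Rightarrow> nat \<Rightarrow> ('v \<Rightarrow> 'v \<Rightarrow> bit) \<Rightarrow>
   (nat \<Rightarrow> 'v) \<Rightarrow> 'w \<Rightarrow> ('v \<Rightarrow> 'w) \<Rightarrow> ('w \<Rightarrow> bit) \<Rightarrow> ('w \<Rightarrow> bit) \<Rightarrow> bool" where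
  "s_related V W g d \<sigma> \<nu>0 s \<psi> \<psi>' \<longleftrightarrow>
     (\<exists>f\<in>symplectic_auts V d. \<forall>a\<in>carrier W. \<psi> a = \<psi>' (section_lift W g \<sigma> \<nu>0 s f a))"

end

theory Submission
  imports Defs
begin

text \<open>
  The forms \<open>\<omega> = \<psi> \<circ> s\<close> and \<open>\<omega>' = \<psi>' \<circ> s\<close> have the same polar form, the intersection product
  \<open>d\<close>. Hence \<open>\<omega> + \<omega>'\<close> is linear, and since \<open>d\<close> is nondegenerate it is \<open>d _ c\<close> for a single
  vector \<open>c\<close>; in a symplectic basis a direct expansion gives \<open>Arf(\<omega>) = Arf(\<omega>') + \<omega>'(c)\<close>
  (\<open>arf_invariant_translate\<close>). If \<open>\<omega>'(c) = 0\<close>, the transvection \<open>a \<mapsto> a + d(a, c) c\<close> carries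
  \<open>\<omega>'\<close> to \<open>\<omega>\<close>. If \<open>\<omega>'(c) = 1\<close>, translation by \<open>c\<close> shows that the Gauss sums
  \<open>\<Sum>\<^sub>a (-1)\<^bsup>\<omega>(a)\<^esup>\<close> of the two forms are opposite; their square is the order of the space, so
  they are nonzero and no bijection carries one form to the other. This is
  \<open>quadratic_forms_equivalent_iff_arf\<close>.

  To pass from forms on \<open>V = H\<^sub>1(F)\<close> to functionals on \<open>W = H\<^sub>1(P)\<close>, every element of \<open>W\<close> is
  written uniquely as \<open>s(a) + t \<nu>\<^sub>0\<close>. In these coordinates the lift of a symplectic automorphism
  \<open>f\<close> is \<open>s(a) + t \<nu>\<^sub>0 \<mapsto> s(f(a)) + t \<nu>\<^sub>0\<close>, so \<open>\<psi> = \<psi>' \<circ> f\<^sub>s\<close> says exactly that \<open>\<omega> = \<omega>' \<circ> f\<close>.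
  Existence of the coordinates holds because the \<open>\<nu>\<^sub>i\<close> generate \<open>W\<close>. Uniqueness needs enough
  functionals on \<open>W\<close>: one taking the value \<open>1\<close> at \<open>\<nu>\<^sub>0\<close> comes from the monodromy of a special
  covering, and for each \<open>c \<in> V\<close> one that vanishes at \<open>\<nu>\<^sub>0\<close> and maps \<open>s(a)\<close> to \<open>d(a, c)\<close> is
  obtained from the homomorphism \<open>C \<mapsto> d(h(p(C)), c)\<close> on \<open>\<pi>\<^sub>1(P)\<close>.

  The topological input is the Hurewicz theorem in degree one with mod 2 coefficients: for a
  path-connected space the Hurewicz map is a surjective homomorphism (\<open>hurewicz_surj\<close>), and every
  homomorphism from the fundamental group to \<open>\<int>\<^sub>2\<close> factors through it
  (\<open>functional_through_hurewicz\<close>). Paths and singular 2-simplices in the space are handled by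
  mapping segments and triangles of convex sets into it (\<open>homotopic_paths_compose_convex\<close>, \<open>edge_triangle\<close>,
  \<open>simplex_2_homotopic\<close>).
\<close>

section \<open>The field with two elements\<close>

text \<open>The default simplification of arithmetic on \<^typ>\<open>bit\<close> into boolean operations, of \<open>1\<close> into a
  successor and of \<open>n * Suc m\<close> would destroy the additive structure and the indices \<open>2 * j - 1\<close>
  used below.\<close>

declare add_bit_eq_xor [simp del] mult_bit_eq_and [simp del] One_nat_def [simp del] mult_Suc_right [simp del]

lemma bit_add_self [simp]:
  fixes a b :: bit
  shows "a + a = 0" "a + (a + b) = b"
  by (cases a; cases b; simp)+

lemma bit_mult_expand:
  fixes a b x y :: bit
  shows "(x + b) * (y + a) = x * y + (a * x + b * y + a * b)"
  by (cases a; cases b; cases x; cases y; simp)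

lemma comm_group_Z2: "comm_group Z2"
proof (rule comm_groupI)
  show "\<exists>b\<in>carrier Z2. b \<otimes>\<^bsub>Z2\<^esub> a = \<one>\<^bsub>Z2\<^esub>" for a
    by (rule bexI[of _ a]) (cases a; simp add: Z2_def)+
qed (auto simp: Z2_def ac_simps)

lemma carrier_Z2 [simp]: "carrier Z2 = UNIV" and mult_Z2 [simp]: "a \<otimes>\<^bsub>Z2\<^esub> b = a + b"
  and one_Z2 [simp]: "\<one>\<^bsub>Z2\<^esub> = 0"
  by (simp_all add: Z2_def)

lemma hom_Z2_mult: "f \<in> hom G Z2 \<Longrightarrow> a \<in> carrier G \<Longrightarrow> b \<in> carrier G \<Longrightarrow> f (a \<otimes>\<^bsub>G\<^esub> b) = f a + f b"
  by (simp add: hom_def)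

lemma hom_Z2_one:
  assumes "f \<in> hom G Z2" "group G"
  shows "f \<one>\<^bsub>G\<^esub> = 0"
  using hom_one[OF assms(1,2)] comm_group.axioms(2)[OF comm_group_Z2] by simp

section \<open>Quadratic forms and the Arf invariant\<close>

locale symplectic_space = comm_group V for V :: "('v, 'm) monoid_scheme" (structure) +
  fixes g :: nat and \<sigma> :: "nat \<Rightarrow> 'v" and d :: "'v \<Rightarrow> 'v \<Rightarrow> bit"
  assumes exponent_two: "a \<in> carrier V \<Longrightarrow> a \<otimes> a = \<one>"
    and basis_closed: "i \<in> {1..2 * g} \<Longrightarrow> \<sigma> i \<in> carrier V"
    and basis_generates: "generate V (\<sigma> ` {1..2 * g}) = carrier V"
    and intersection: "intersection_product V g \<sigma> d"
begin

definition quadratic_form :: "('v \<Rightarrow> bit) \<Rightarrow> bool" where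
  "quadratic_form \<omega> \<longleftrightarrow>
     (\<forall>a\<in>carrier V. \<forall>b\<in>carrier V. \<omega> (a \<otimes> b) = \<omega> a + \<omega> b + d a b)"

text \<open>The combination of the first \<open>k\<close> symplectic pairs with coefficients \<open>\<alpha>\<close> at the odd and \<open>\<beta>\<close> at
  the even basis vectors. Keeping the two families apart and the number of pairs variable lets
  sums over pairs be computed by induction on \<open>k\<close>.\<close>

definition combination :: "(nat \<Rightarrow> bit) \<Rightarrow> (nat \<Rightarrow> bit) \<Rightarrow> nat \<Rightarrow> 'v" where
  "combination \<alpha> \<beta> k =
     finprod V (\<lambda>j. scale V (\<alpha> j) (\<sigma> (2 * j - 1)) \<otimes> scale V (\<beta> j) (\<sigma> (2 * j))) {1..k}"

lemma d_add_left:
  "\<lbrakk>a \<in> carrier V; b \<in> carrier V; c \<in> carrier V\<rbrakk> \<Longrightarrow> d (a \<otimes> b) c = d a c + d b c"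
  and d_add_right:
  "\<lbrakk>a \<in> carrier V; b \<in> carrier V; c \<in> carrier V\<rbrakk> \<Longrightarrow> d c (a \<otimes> b) = d c a + d c b"
  and d_self: "a \<in> carrier V \<Longrightarrow> d a a = 0"
  using intersection by (auto simp: intersection_product_def)

lemma d_sym: "a \<in> carrier V \<Longrightarrow> b \<in> carrier V \<Longrightarrow> d a b = d b a"
  using d_self[of "a \<otimes> b"] d_self[of a] d_self[of b]
  by (cases "d a b"; cases "d b a") (simp_all add: d_add_left d_add_right)

lemma d_one [simp]: "a \<in> carrier V \<Longrightarrow> d \<one> a = 0" "a \<in> carrier V \<Longrightarrow> d a \<one> = 0"
  using d_add_left[of \<one> \<one> a] d_add_right[of \<one> \<one> a] by simp_all

lemma d_basis:
  assumes "i \<in> {1..2 * g}" "j \<in> {1..2 * g}" "i \<noteq> j"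
  shows "d (\<sigma> i) (\<sigma> j) = (if \<exists>k\<in>{1..g}. {i, j} = {2 * k - 1, 2 * k} then 1 else 0)"
  using intersection assms by (simp add: intersection_product_def)

lemma odd_even_index:
  fixes i j :: nat
  assumes "1 \<le> i"
  shows "2 * i - 1 \<noteq> 2 * j" "2 * j \<noteq> 2 * i - 1"
  using assms by presburger+

lemma d_symplectic_pairs:
  assumes i: "i \<in> {1..g}" and j: "j \<in> {1..g}"
  shows "d (\<sigma> (2 * i - 1)) (\<sigma> (2 * j)) = of_bool (i = j)"
    and "d (\<sigma> (2 * i)) (\<sigma> (2 * j - 1)) = of_bool (i = j)"
    and "d (\<sigma> (2 * i - 1)) (\<sigma> (2 * j - 1)) = 0"
    and "d (\<sigma> (2 * i)) (\<sigma> (2 * j)) = 0"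
proof -
  have m: "2 * i - 1 \<in> {1..2 * g}" "2 * i \<in> {1..2 * g}" "2 * j - 1 \<in> {1..2 * g}" "2 * j \<in> {1..2 * g}"
    using i j by auto
  have *: "(\<exists>k\<in>{1..g}. {2 * i - 1, 2 * j} = {2 * k - 1, 2 * k}) \<longleftrightarrow> i = j"
    using i j odd_even_index by (auto simp: doubleton_eq_iff)
  have **: "(\<exists>k\<in>{1..g}. {2 * i, 2 * j - 1} = {2 * k - 1, 2 * k}) \<longleftrightarrow> i = j"
    using i j odd_even_index by (auto simp: doubleton_eq_iff)
  show "d (\<sigma> (2 * i - 1)) (\<sigma> (2 * j)) = of_bool (i = j)"
    using d_basis[OF m(1,4)] i odd_even_index[of i j] unfolding * by simp
  show "d (\<sigma> (2 * i)) (\<sigma> (2 * j - 1)) = of_bool (i = j)"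
    using d_basis[OF m(2,3)] j odd_even_index[of j i] unfolding ** by simp
  show "d (\<sigma> (2 * i - 1)) (\<sigma> (2 * j - 1)) = 0"
  proof (cases "i = j")
    case False
    have "\<not> (\<exists>k\<in>{1..g}. {2 * i - 1, 2 * j - 1} = {2 * k - 1, 2 * k})"
      using i j odd_even_index by (auto simp: doubleton_eq_iff)
    then show ?thesis using d_basis[OF m(1,3)] i j False by auto
  qed (use m basis_closed d_self in simp)
  show "d (\<sigma> (2 * i)) (\<sigma> (2 * j)) = 0"
  proof (cases "i = j")
    case False
    have "\<not> (\<exists>k\<in>{1..g}. {2 * i, 2 * j} = {2 * k - 1, 2 * k})"
      using i j odd_even_index by (auto simp: doubleton_eq_iff)
    then show ?thesis using d_basis[OF m(2,4)] i j False by auto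
  qed (use m basis_closed d_self in simp)
qed

lemma scale_closed [simp]: "v \<in> carrier V \<Longrightarrow> scale V r v \<in> carrier V"
  by (simp add: scale_def)

lemma basis_pair_closed [simp]:
  assumes "j \<in> {1..g}" shows "\<sigma> (2 * j - 1) \<in> carrier V" "\<sigma> (2 * j) \<in> carrier V"
  using assms by (auto intro!: basis_closed)

lemma combination_closed [simp]: "k \<le> g \<Longrightarrow> combination \<alpha> \<beta> k \<in> carrier V"
  unfolding combination_def by (intro finprod_closed) (auto intro!: m_closed scale_closed basis_closed)

lemma combination_0 [simp]: "combination \<alpha> \<beta> 0 = \<one>"
  by (simp add: combination_def)

lemma combination_Suc:
  assumes "Suc k \<le> g"
  shows "combination \<alpha> \<beta> (Suc k) = combination \<alpha> \<beta> k \<otimes>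
     (scale V (\<alpha> (Suc k)) (\<sigma> (2 * Suc k - 1)) \<otimes> scale V (\<beta> (Suc k)) (\<sigma> (2 * Suc k)))"
proof -
  have "{1..Suc k} = insert (Suc k) {1..k}" by auto
  moreover have "combination \<alpha> \<beta> k \<in> carrier V" using assms by simp
  moreover have "j \<in> {1..g}" if "j \<in> {1..Suc k}" for j using that assms by simp
  ultimately show ?thesis
    unfolding combination_def
    by (subst \<open>{1..Suc k} = _\<close>, subst finprod_insert)
       (use assms in \<open>auto intro!: m_comm m_closed scale_closed basis_pair_closed finprod_closed\<close>)
qed

lemma additive_scale:
  assumes "\<And>a b. a \<in> carrier V \<Longrightarrow> b \<in> carrier V \<Longrightarrow> L (a \<otimes> b) = L a + L b" "v \<in> carrier V"
  shows "(L (scale V r v) :: bit) = r * L v"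
  using assms(1)[of \<one> \<one>] by (cases r) (auto simp: scale_def)

lemma additive_combination:
  assumes L: "\<And>a b. a \<in> carrier V \<Longrightarrow> b \<in> carrier V \<Longrightarrow> L (a \<otimes> b) = L a + L b" and "k \<le> g"
  shows "(L (combination \<alpha> \<beta> k) :: bit) =
    (\<Sum>j = 1..k. \<alpha> j * L (\<sigma> (2 * j - 1)) + \<beta> j * L (\<sigma> (2 * j)))"
  using \<open>k \<le> g\<close>
proof (induction k)
  case 0
  then show ?case using L[of \<one> \<one>] by simp
next
  case (Suc k)
  have [simp]: "\<sigma> (2 * Suc k - 1) \<in> carrier V" "\<sigma> (2 * Suc k) \<in> carrier V"
    using Suc.prems basis_pair_closed[of "Suc k"] by simp_all
  show ?case
    unfolding combination_Suc[OF Suc.prems]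
    using Suc by (simp add: L additive_scale[OF L])
qed

text \<open>Pairing with a basis vector reads off the coefficient of the dual basis vector, which is what
  makes \<open>d\<close> nondegenerate and every linear functional a pairing.\<close>

lemma d_combination:
  assumes "i \<in> {1..g}"
  shows "d (\<sigma> (2 * i - 1)) (combination \<alpha> \<beta> g) = \<beta> i"
    and "d (\<sigma> (2 * i)) (combination \<alpha> \<beta> g) = \<alpha> i"
proof -
  have "d (\<sigma> (2 * i - 1)) (combination \<alpha> \<beta> g) = (\<Sum>j = 1..g. if i = j then \<beta> j else 0)"
    by (subst additive_combination)
       (auto intro!: sum.cong d_add_right basis_closed simp: d_symplectic_pairs assms,
         use assms in auto)
  then show "d (\<sigma> (2 * i - 1)) (combination \<alpha> \<beta> g) = \<beta> i" using assms by simp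
  have "d (\<sigma> (2 * i)) (combination \<alpha> \<beta> g) = (\<Sum>j = 1..g. if i = j then \<alpha> j else 0)"
    by (subst additive_combination)
       (auto intro!: sum.cong d_add_right basis_closed simp: d_symplectic_pairs assms,
         use assms in auto)
  then show "d (\<sigma> (2 * i)) (combination \<alpha> \<beta> g) = \<alpha> i" using assms by simp
qed

lemma combination_mult:
  "k \<le> g \<Longrightarrow> combination \<alpha> \<beta> k \<otimes> combination \<alpha>' \<beta>' k =
     combination (\<lambda>j. \<alpha> j + \<alpha>' j) (\<lambda>j. \<beta> j + \<beta>' j) k"
proof (induction k)
  case (Suc k)
  have cl: "\<sigma> (2 * Suc k - 1) \<in> carrier V" "\<sigma> (2 * Suc k) \<in> carrier V"
    using Suc.prems basis_pair_closed[of "Suc k"] by simp_all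
  have sc: "scale V (r + r') v = scale V r v \<otimes> scale V r' v" if "v \<in> carrier V" for r r' v
    using that by (cases r; cases r') (auto simp: scale_def exponent_two)
  have "combination \<alpha> \<beta> k \<in> carrier V" "combination \<alpha>' \<beta>' k \<in> carrier V"
    "combination (\<lambda>j. \<alpha> j + \<alpha>' j) (\<lambda>j. \<beta> j + \<beta>' j) k \<in> carrier V"
    using Suc.prems by simp_all
  then show ?case
    unfolding combination_Suc[OF Suc.prems] sc[OF cl(1)] sc[OF cl(2)] Suc.IH[OF Suc_leD[OF Suc.prems], symmetric]
    using cl by (simp add: m_ac)
qed simp

text \<open>The combinations form a subgroup, because the space has exponent two, and they contain the
  generating basis vectors.\<close>

lemma exists_combination:
  assumes "a \<in> carrier V"
  obtains \<alpha> \<beta> where "a = combination \<alpha> \<beta> g"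
proof -
  have basis: "\<exists>\<alpha> \<beta>. \<sigma> i = combination \<alpha> \<beta> g" if i: "i \<in> {1..2 * g}" for i
  proof -
    \<comment> \<open>As \<open>k\<close> grows, the partial combination stays trivial until the pair \<open>m\<close> that contains \<open>\<sigma> i\<close>.\<close>
    have single: "combination (\<lambda>j. of_bool (j = m \<and> odd i)) (\<lambda>j. of_bool (j = m \<and> even i)) k =
        (if m \<le> k then \<sigma> i else \<one>)" if "k \<le> g" "m \<in> {1..g}" "i = 2 * m - 1 \<or> i = 2 * m" for k m
      using \<open>k \<le> g\<close>
    proof (induction k)
      case (Suc k)
      have "\<sigma> i \<in> carrier V" using basis_closed i by blast
      then show ?case
        using Suc that by (subst combination_Suc) (auto simp: scale_def le_Suc_eq)
    qed (use that in simp)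
    define m where "m = (i + 1) div 2"
    have "m \<in> {1..g}" "i = 2 * m - 1 \<or> i = 2 * m" using i unfolding m_def by auto
    then have "combination (\<lambda>j. of_bool (j = m \<and> odd i)) (\<lambda>j. of_bool (j = m \<and> even i)) g = \<sigma> i"
      using single[of g m] by simp
    then show ?thesis by metis
  qed
  have "a \<in> generate V (\<sigma> ` {1..2 * g})" using assms basis_generates by simp
  then have "\<exists>\<alpha> \<beta>. a = combination \<alpha> \<beta> g"
  proof (induction rule: generate.induct)
    case one
    have "combination (\<lambda>_. 0) (\<lambda>_. 0) g = \<one>"
      unfolding combination_def by (rule finprod_one_eqI) (simp add: scale_def)
    then show ?case by metis
  next
    case (incl h)
    then show ?case using basis by auto
  next
    case (inv h)
    then have "inv h = h" by (auto intro!: inv_equality exponent_two basis_closed)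
    then show ?case using inv basis by auto
  next
    case (eng h1 h2)
    then show ?case using combination_mult[of g] by (metis order_refl)
  qed
  then show ?thesis using that by blast
qed

lemma finite_carrier: "finite (carrier V)"
proof -
  have "carrier V \<subseteq> (\<lambda>(\<alpha>, \<beta>). combination \<alpha> \<beta> g) ` ((PiE {1..g} (\<lambda>_. UNIV)) \<times> (PiE {1..g} (\<lambda>_. UNIV)))"
  proof
    fix a assume "a \<in> carrier V"
    then obtain \<alpha> \<beta> where a: "a = combination \<alpha> \<beta> g" by (rule exists_combination)
    have "combination \<alpha> \<beta> g = combination (restrict \<alpha> {1..g}) (restrict \<beta> {1..g}) g"
      unfolding combination_def
      by (intro finprod_cong) (auto intro!: m_closed scale_closed basis_closed)
    with a show "a \<in> (\<lambda>(\<alpha>, \<beta>). combination \<alpha> \<beta> g) ` ((PiE {1..g} (\<lambda>_. UNIV)) \<times> (PiE {1..g} (\<lambda>_. UNIV)))"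
      by (intro image_eqI[of _ _ "(restrict \<alpha> {1..g}, restrict \<beta> {1..g})"]) auto
  qed
  moreover have "finite (UNIV :: bit set)"
    by (rule finite_subset[of _ "{0, 1}"]) (auto intro: bit.exhaust)
  ultimately show ?thesis
    by (meson finite_PiE finite_SigmaI finite_atLeastAtMost finite_imageI finite_subset)
qed

lemma nondegenerate:
  assumes a: "a \<in> carrier V" and "\<And>b. b \<in> carrier V \<Longrightarrow> d b a = 0"
  shows "a = \<one>"
proof -
  obtain \<alpha> \<beta> where c: "a = combination \<alpha> \<beta> g" using a by (rule exists_combination)
  have "\<alpha> j = 0" "\<beta> j = 0" if "j \<in> {1..g}" for j
    using d_combination[OF that, of \<alpha> \<beta>] assms(2) c basis_pair_closed that by auto
  then show ?thesis
    unfolding c combination_def by (intro finprod_one_eqI) (simp add: scale_def)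
qed

lemma additive_eqI:
  assumes "\<And>a b. a \<in> carrier V \<Longrightarrow> b \<in> carrier V \<Longrightarrow> (L (a \<otimes> b) :: bit) = L a + L b"
    and "\<And>a b. a \<in> carrier V \<Longrightarrow> b \<in> carrier V \<Longrightarrow> (L' (a \<otimes> b) :: bit) = L' a + L' b"
    and basis: "\<And>i. i \<in> {1..2 * g} \<Longrightarrow> L (\<sigma> i) = L' (\<sigma> i)" and a: "a \<in> carrier V"
  shows "L a = L' a"
proof -
  obtain \<alpha> \<beta> where ab: "a = combination \<alpha> \<beta> g" using a by (rule exists_combination)
  have "L a = (\<Sum>j = 1..g. \<alpha> j * L (\<sigma> (2 * j - 1)) + \<beta> j * L (\<sigma> (2 * j)))"
    unfolding ab by (rule additive_combination) (auto intro: assms(1))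
  also have "\<dots> = (\<Sum>j = 1..g. \<alpha> j * L' (\<sigma> (2 * j - 1)) + \<beta> j * L' (\<sigma> (2 * j)))"
  proof (rule sum.cong[OF HOL.refl])
    fix j assume "j \<in> {1..g}"
    then have "2 * j - 1 \<in> {1..2 * g}" "2 * j \<in> {1..2 * g}" by auto
    then show "\<alpha> j * L (\<sigma> (2 * j - 1)) + \<beta> j * L (\<sigma> (2 * j)) = \<alpha> j * L' (\<sigma> (2 * j - 1)) + \<beta> j * L' (\<sigma> (2 * j))"
      by (simp add: basis)
  qed
  also have "\<dots> = L' a"
    unfolding ab by (rule additive_combination[symmetric]) (auto intro: assms(2))
  finally show ?thesis .
qed

text \<open>The coefficients of the representing vector are the values of the functional at the dual basis
  vectors.\<close>

lemma additive_eq_d: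
  assumes L: "\<And>a b. a \<in> carrier V \<Longrightarrow> b \<in> carrier V \<Longrightarrow> L (a \<otimes> b) = L a + L b"
  obtains c where "c \<in> carrier V" "\<And>a. a \<in> carrier V \<Longrightarrow> L a = d a c"
proof
  let ?c = "combination (\<lambda>j. L (\<sigma> (2 * j))) (\<lambda>j. L (\<sigma> (2 * j - 1))) g"
  show c: "?c \<in> carrier V" by simp
  fix a assume "a \<in> carrier V"
  then obtain \<alpha> \<beta> where a: "a = combination \<alpha> \<beta> g" by (rule exists_combination)
  have "L a = (\<Sum>j = 1..g. \<alpha> j * L (\<sigma> (2 * j - 1)) + \<beta> j * L (\<sigma> (2 * j)))"
    unfolding a by (rule additive_combination) (auto intro: L)
  also have "\<dots> = (\<Sum>j = 1..g. \<alpha> j * d (\<sigma> (2 * j - 1)) ?c + \<beta> j * d (\<sigma> (2 * j)) ?c)"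
    by (intro sum.cong) (auto simp: d_combination)
  also have "\<dots> = d a ?c"
    unfolding a by (rule additive_combination[symmetric]) (auto intro: d_add_left c)
  finally show "L a = d a ?c" .
qed

lemma quadratic_formD:
  "\<lbrakk>quadratic_form \<omega>; a \<in> carrier V; b \<in> carrier V\<rbrakk> \<Longrightarrow> \<omega> (a \<otimes> b) = \<omega> a + \<omega> b + d a b"
  by (simp add: quadratic_form_def)

lemma quadratic_form_one: "quadratic_form \<omega> \<Longrightarrow> \<omega> \<one> = 0"
  using quadratic_formD[of \<omega> \<one> \<one>] by simp

text \<open>Distinct symplectic pairs are orthogonal, so a quadratic form is the sum of its restrictions
  to the planes that they span; on one plane the cross term \<open>\<alpha> \<beta>\<close> comes from
  \<open>d (\<sigma> (2 j - 1)) (\<sigma> (2 j)) = 1\<close>.\<close>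

lemma quadratic_form_combination:
  assumes \<omega>: "quadratic_form \<omega>" and "k \<le> g"
  shows "\<omega> (combination \<alpha> \<beta> k) =
    (\<Sum>j = 1..k. \<alpha> j * \<omega> (\<sigma> (2 * j - 1)) + \<beta> j * \<omega> (\<sigma> (2 * j)) + \<alpha> j * \<beta> j)"
  using \<open>k \<le> g\<close>
proof (induction k)
  case 0
  then show ?case using quadratic_form_one[OF \<omega>] by simp
next
  case (Suc k)
  let ?x = "\<sigma> (2 * Suc k - 1)" and ?y = "\<sigma> (2 * Suc k)"
  let ?m = "scale V (\<alpha> (Suc k)) ?x \<otimes> scale V (\<beta> (Suc k)) ?y"
  have S: "Suc k \<in> {1..g}" using Suc.prems by simp
  have xy: "?x \<in> carrier V" "?y \<in> carrier V" using basis_pair_closed[OF S] .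
  have dxy: "d ?x ?y = 1" using d_symplectic_pairs(1)[OF S S] by simp
  have m: "\<omega> ?m = \<alpha> (Suc k) * \<omega> ?x + \<beta> (Suc k) * \<omega> ?y + \<alpha> (Suc k) * \<beta> (Suc k)"
    using xy dxy quadratic_formD[OF \<omega> xy] quadratic_form_one[OF \<omega>]
    by (cases "\<alpha> (Suc k)"; cases "\<beta> (Suc k)") (simp_all add: scale_def)
  have "d (combination \<alpha> \<beta> k) ?m =
      (\<Sum>j = 1..k. \<alpha> j * d (\<sigma> (2 * j - 1)) ?m + \<beta> j * d (\<sigma> (2 * j)) ?m)"
    by (rule additive_combination) (use xy Suc.prems in \<open>auto intro!: d_add_left\<close>)
  also have "\<dots> = 0"
  proof (rule sum.neutral, rule ballI)
    fix j assume "j \<in> {1..k}"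
    then have j: "j \<in> {1..g}" "j \<noteq> Suc k" using Suc.prems by auto
    have "d v ?m = \<alpha> (Suc k) * d v ?x + \<beta> (Suc k) * d v ?y" if "v \<in> carrier V" for v
      using xy that by (simp add: d_add_right additive_scale[of "d v"])
    then show "\<alpha> j * d (\<sigma> (2 * j - 1)) ?m + \<beta> j * d (\<sigma> (2 * j)) ?m = 0"
      using basis_pair_closed[OF j(1)] d_symplectic_pairs[OF j(1) S] j(2) by simp
  qed
  finally have "d (combination \<alpha> \<beta> k) ?m = 0" .
  moreover have "?m \<in> carrier V" "combination \<alpha> \<beta> k \<in> carrier V" using xy Suc.prems by simp_all
  ultimately show ?case
    unfolding combination_Suc[OF Suc.prems] quadratic_formD[OF \<omega> \<open>combination \<alpha> \<beta> k \<in> _\<close> \<open>?m \<in> _\<close>]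
    using Suc by (simp add: m)
qed

text \<open>Adding \<open>d _ c\<close> changes the factors of the \<open>j\<close>-th summand of the Arf invariant by the
  coefficients of \<open>c\<close>, and expanding the product produces the summands of
  \<open>quadratic_form_combination\<close> for \<open>\<omega> c\<close>.\<close>

lemma arf_invariant_translate:
  assumes \<omega>: "quadratic_form \<omega>" and c: "c \<in> carrier V"
    and \<omega>': "\<And>a. a \<in> carrier V \<Longrightarrow> \<omega>' a = \<omega> a + d a c"
  shows "arf_invariant g \<sigma> \<omega>' = arf_invariant g \<sigma> \<omega> + \<omega> c"
proof -
  obtain \<alpha> \<beta> where ab: "c = combination \<alpha> \<beta> g" using c by (rule exists_combination)
  have "arf_invariant g \<sigma> \<omega>' =
      (\<Sum>j = 1..g. (\<omega> (\<sigma> (2 * j - 1)) + \<beta> j) * (\<omega> (\<sigma> (2 * j)) + \<alpha> j))"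
    unfolding arf_invariant_def
    by (intro sum.cong HOL.refl) (auto simp: \<omega>' ab d_combination)
  also have "\<dots> = arf_invariant g \<sigma> \<omega> + \<omega> c"
    unfolding ab arf_invariant_def quadratic_form_combination[OF \<omega> le_refl] sum.distrib[symmetric]
    by (rule sum.cong[OF HOL.refl]) (rule bit_mult_expand)
  finally show ?thesis .
qed

definition bit_sign :: "bit \<Rightarrow> int" where
  "bit_sign b = (if b = 0 then 1 else -1)"

definition gauss_sum :: "('v \<Rightarrow> bit) \<Rightarrow> int" where
  "gauss_sum \<omega> = (\<Sum>a\<in>carrier V. bit_sign (\<omega> a))"

lemma bit_sign_add: "bit_sign (a + b) = bit_sign a * bit_sign b"
  by (cases a; cases b) (auto simp: bit_sign_def)

lemma bij_translate: "c \<in> carrier V \<Longrightarrow> bij_betw (\<lambda>a. c \<otimes> a) (carrier V) (carrier V)"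
  by (rule bij_betw_byWitness[of _ "\<lambda>a. c \<otimes> a"]) (auto simp: exponent_two simp flip: m_assoc)

lemma sum_translate:
  "c \<in> carrier V \<Longrightarrow> (\<Sum>a\<in>carrier V. f (c \<otimes> a)) = (\<Sum>a\<in>carrier V. f a)"
  using sum.reindex_bij_betw[OF bij_translate, of c f] .

text \<open>For \<open>t \<noteq> 0\<close> there is \<open>b\<close> with \<open>d b t = 1\<close>, and translation by \<open>b\<close> reverses all signs.\<close>

lemma sum_sign_d:
  assumes t: "t \<in> carrier V"
  shows "(\<Sum>a\<in>carrier V. bit_sign (d a t)) = (if t = \<one> then int (card (carrier V)) else 0)"
proof (cases "t = \<one>")
  case False
  then obtain b where b: "b \<in> carrier V" "d b t = 1"
    using nondegenerate[OF t] by (metis bit_not_one_iff)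
  have "(\<Sum>a\<in>carrier V. bit_sign (d a t)) = (\<Sum>a\<in>carrier V. bit_sign (d (b \<otimes> a) t))"
    using sum_translate[OF b(1), of "\<lambda>a. bit_sign (d a t)"] by simp
  also have "\<dots> = (\<Sum>a\<in>carrier V. - bit_sign (d a t))"
    using b t by (intro sum.cong) (auto simp: d_add_left bit_sign_add, auto simp: bit_sign_def)
  finally show ?thesis using False by (simp add: sum_negf)
qed (simp add: bit_sign_def)

text \<open>Substituting \<open>b = a + t\<close> in the double sum gives \<open>\<omega> a + \<omega> b = \<omega> t + d a t\<close>; for fixed \<open>t\<close> the
  sum over \<open>a\<close> vanishes unless \<open>t = 0\<close>.\<close>

lemma gauss_sum_square:
  assumes \<omega>: "quadratic_form \<omega>"
  shows "gauss_sum \<omega> * gauss_sum \<omega> = int (card (carrier V))"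
proof -
  have "gauss_sum \<omega> * gauss_sum \<omega> =
      (\<Sum>a\<in>carrier V. bit_sign (\<omega> a) * (\<Sum>t\<in>carrier V. bit_sign (\<omega> (a \<otimes> t))))"
    unfolding gauss_sum_def sum_distrib_right
    by (rule sum.cong[OF HOL.refl], rule arg_cong[of _ _ "(*) _"])
       (rule sum_translate[symmetric, where f = "\<lambda>a. bit_sign (\<omega> a)"])
  also have "\<dots> = (\<Sum>a\<in>carrier V. \<Sum>t\<in>carrier V. bit_sign (\<omega> t) * bit_sign (d a t))"
    unfolding sum_distrib_left
    by (intro sum.cong HOL.refl) (simp add: quadratic_formD[OF \<omega>] bit_sign_add, simp add: bit_sign_def)
  also have "\<dots> = (\<Sum>t\<in>carrier V. bit_sign (\<omega> t) * (\<Sum>a\<in>carrier V. bit_sign (d a t)))"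
    unfolding sum_distrib_left by (rule sum.swap)
  also have "\<dots> = (\<Sum>t\<in>carrier V. if t = \<one> then int (card (carrier V)) else 0)"
    using quadratic_form_one[OF \<omega>] by (intro sum.cong HOL.refl) (simp add: sum_sign_d, simp add: bit_sign_def)
  finally show ?thesis using finite_carrier by simp
qed

lemma transvection_symplectic:
  assumes c: "c \<in> carrier V"
  shows "(\<lambda>a. a \<otimes> scale V (d a c) c) \<in> symplectic_auts V d"
proof -
  let ?T = "\<lambda>a. a \<otimes> scale V (d a c) c"
  have cl: "?T a \<in> carrier V" if "a \<in> carrier V" for a using that c by simp
  have cancel: "c \<otimes> (c \<otimes> b) = b" if "b \<in> carrier V" for b
    using that c exponent_two[OF c] by (simp flip: m_assoc)
  have add: "?T (a \<otimes> b) = ?T a \<otimes> ?T b" if "a \<in> carrier V" "b \<in> carrier V" for a b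
    using that c exponent_two[OF c] cancel
    by (cases "d a c"; cases "d b c") (simp_all add: scale_def d_add_left m_ac)
  have dT: "d (?T a) c = d a c" if "a \<in> carrier V" for a
    using that c by (simp add: d_add_left scale_def d_self)
  have inv: "?T (?T a) = a" if "a \<in> carrier V" for a
    using dT[OF that] that c exponent_two[OF c] by (auto simp: scale_def m_assoc)
  have pres: "d (?T a) (?T b) = d a b" if "a \<in> carrier V" "b \<in> carrier V" for a b
    using that c d_sym[OF c that(2)] d_sym[OF c that(1)] d_self[OF c]
    by (cases "d a c"; cases "d b c") (auto simp: scale_def d_add_left d_add_right)
  have "bij_betw ?T (carrier V) (carrier V)"
    by (rule bij_betw_byWitness[of _ ?T]) (use inv cl in auto)
  then show ?thesis
    using cl add pres by (auto simp: symplectic_auts_def iso_def hom_def)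
qed

text \<open>The forms differ by \<open>d _ c\<close>, and their Arf invariants by \<open>\<omega>' c\<close>. The transvection by \<open>c\<close> is an
  equivalence if this value is zero; otherwise the Gauss sums, which are invariant under
  bijections, have opposite signs.\<close>

theorem quadratic_forms_equivalent_iff_arf:
  assumes \<omega>: "quadratic_form \<omega>" and \<omega>': "quadratic_form \<omega>'"
  shows "(\<exists>f\<in>symplectic_auts V d. \<forall>a\<in>carrier V. \<omega> a = \<omega>' (f a)) \<longleftrightarrow>
    arf_invariant g \<sigma> \<omega> = arf_invariant g \<sigma> \<omega>'"
proof -
  \<comment> \<open>The polar forms cancel in characteristic two, so the sum is additive.\<close>
  obtain c where c: "c \<in> carrier V" "\<And>a. a \<in> carrier V \<Longrightarrow> \<omega> a + \<omega>' a = d a c"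
    by (rule additive_eq_d[of "\<lambda>a. \<omega> a + \<omega>' a"])
       (auto simp: quadratic_formD[OF \<omega>] quadratic_formD[OF \<omega>'] ac_simps)
  have \<omega>_eq: "\<omega> a = \<omega>' a + d a c" if "a \<in> carrier V" for a
    using c(2)[OF that, symmetric] by (simp add: ac_simps)
  have arf: "arf_invariant g \<sigma> \<omega> = arf_invariant g \<sigma> \<omega>' + \<omega>' c"
    by (rule arf_invariant_translate[OF \<omega>' c(1) \<omega>_eq])
  show ?thesis
  proof (cases "\<omega>' c = 0")
    case True
    have "\<omega> a = \<omega>' (a \<otimes> scale V (d a c) c)" if a: "a \<in> carrier V" for a
      using \<omega>_eq[OF a] True a c(1)
      by (cases "d a c") (auto simp: scale_def quadratic_formD[OF \<omega>'])
    then show ?thesis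
      using transvection_symplectic[OF c(1)] arf True by auto
  next
    case False
    then have one: "\<omega>' c = 1" by simp
    have "\<omega>' (c \<otimes> a) = \<omega> a + 1" if a: "a \<in> carrier V" for a
      using \<omega>_eq[OF a] one a c(1) m_comm[OF a c(1)] quadratic_formD[OF \<omega>' a c(1)]
      by (simp add: ac_simps)
    then have "gauss_sum \<omega>' = - gauss_sum \<omega>"
      using sum_translate[OF c(1), of "\<lambda>a. bit_sign (\<omega>' a)"]
      by (simp add: gauss_sum_def bit_sign_add) (simp add: bit_sign_def sum_negf)
    moreover have "gauss_sum \<omega> = gauss_sum \<omega>'"
      if f: "f \<in> symplectic_auts V d" and eq: "\<forall>a\<in>carrier V. \<omega> a = \<omega>' (f a)" for f
    proof -
      have "bij_betw f (carrier V) (carrier V)"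
        using f by (simp add: symplectic_auts_def iso_def)
      from sum.reindex_bij_betw[OF this, of "\<lambda>a. bit_sign (\<omega>' a)"] show ?thesis
        using eq by (simp add: gauss_sum_def)
    qed
    moreover have "gauss_sum \<omega> \<noteq> 0"
      using gauss_sum_square[OF \<omega>] finite_carrier one_closed by (force simp: card_eq_0_iff)
    ultimately show ?thesis using arf one by auto
  qed
qed

end

section \<open>Homotopies of paths and the fundamental group\<close>

lemma UN_eq_constant: "A \<noteq> {} \<Longrightarrow> (\<And>x. x \<in> A \<Longrightarrow> f x = B) \<Longrightarrow> (\<Union>x\<in>A. f x) = B"
  by auto

definition loops_at :: "'a::topological_space set \<Rightarrow> 'a \<Rightarrow> (real \<Rightarrow> 'a) set" where
  "loops_at S a = {\<gamma>. path \<gamma> \<and> path_image \<gamma> \<subseteq> S \<and> pathstart \<gamma> = a \<and> pathfinish \<gamma> = a}"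

text \<open>The source of the homotopies for units, inverses and triangles: in a convex set paths with common
  endpoints are homotopic by straight lines, and a continuous map transports the homotopy to a
  space without linear structure.\<close>

lemma homotopic_paths_compose_convex:
  fixes C :: "'c::real_normed_vector set"
  assumes "continuous_on C f" "f ` C \<subseteq> S" "convex C"
    and "path k" "path_image k \<subseteq> C" "path l" "path_image l \<subseteq> C"
    and "pathstart l = pathstart k" "pathfinish l = pathfinish k"
  shows "homotopic_paths S (f \<circ> k) (f \<circ> l)"
proof (rule homotopic_paths_continuous_image)
  show "homotopic_paths C k l"
  proof (rule homotopic_paths_linear)
    fix t :: real assume "t \<in> {0..1}"
    then have "k t \<in> C" "l t \<in> C" using assms by (auto simp: path_image_def)
    then show "closed_segment (k t) (l t) \<subseteq> C" using \<open>convex C\<close> by (simp add: closed_segment_subset)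
  qed (use assms in auto)
qed (use assms in auto)

lemma compose_linepath_01: "\<gamma> \<circ> linepath 0 1 = (\<gamma> :: real \<Rightarrow> 'a)"
  by (auto simp: linepath_def fun_eq_iff)

lemma homotopic_paths_reparam:
  fixes \<gamma> :: "real \<Rightarrow> 'a::topological_space"
  assumes "path \<gamma>" "path_image \<gamma> \<subseteq> S" "path k" "path_image k \<subseteq> {0..1}" "path l" "path_image l \<subseteq> {0..1}"
    and "pathstart l = pathstart k" "pathfinish l = pathfinish k"
  shows "homotopic_paths S (\<gamma> \<circ> k) (\<gamma> \<circ> l)"
  by (rule homotopic_paths_compose_convex[where C = "{0..1}"]) (use assms in \<open>auto simp: path_def path_image_def\<close>)

lemma homotopic_join_const_left:
  fixes \<gamma> :: "real \<Rightarrow> 'a::topological_space"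
  assumes "path \<gamma>" "path_image \<gamma> \<subseteq> S"
  shows "homotopic_paths S ((\<lambda>_. pathstart \<gamma>) +++ \<gamma>) \<gamma>"
proof -
  have "homotopic_paths S (\<gamma> \<circ> (linepath 0 0 +++ linepath 0 1)) (\<gamma> \<circ> linepath 0 1)"
    by (rule homotopic_paths_reparam[OF assms]) (auto simp: path_image_join closed_segment_eq_real_ivl)
  moreover have "\<gamma> \<circ> linepath 0 0 = (\<lambda>_. pathstart \<gamma>)"
    by (auto simp: linepath_def pathstart_def fun_eq_iff)
  ultimately show ?thesis by (simp add: path_compose_join compose_linepath_01)
qed

lemma homotopic_join_reversepath:
  fixes \<gamma> :: "real \<Rightarrow> 'a::topological_space"
  assumes "path \<gamma>" "path_image \<gamma> \<subseteq> S"
  shows "homotopic_paths S (\<gamma> +++ reversepath \<gamma>) (\<lambda>_. pathstart \<gamma>)"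
proof -
  have "homotopic_paths S (\<gamma> \<circ> (linepath 0 1 +++ linepath 1 0)) (\<gamma> \<circ> linepath 0 0)"
    by (rule homotopic_paths_reparam[OF assms]) (auto simp: path_image_join closed_segment_eq_real_ivl)
  moreover have "\<gamma> \<circ> linepath 0 0 = (\<lambda>_. pathstart \<gamma>)" "\<gamma> \<circ> linepath 1 0 = reversepath \<gamma>"
    by (auto simp: linepath_def pathstart_def reversepath_def fun_eq_iff)
  ultimately show ?thesis by (simp add: path_compose_join compose_linepath_01)
qed

lemma homotopic_reversepath_join:
  fixes \<gamma> :: "real \<Rightarrow> 'a::topological_space"
  assumes "path \<gamma>" "path_image \<gamma> \<subseteq> S"
  shows "homotopic_paths S (reversepath \<gamma> +++ \<gamma>) (\<lambda>_. pathfinish \<gamma>)"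
  using homotopic_join_reversepath[of "reversepath \<gamma>" S] assms
  by (simp add: path_reversepath)

lemma loop_class_eq: "homotopic_paths S \<gamma> \<delta> \<Longrightarrow> loop_class S \<gamma> = loop_class S \<delta>"
  by (auto simp: loop_class_def intro: homotopic_paths_trans homotopic_paths_sym)

lemma carrier_fundamental_group: "carrier (fundamental_group S a) = loop_class S ` loops_at S a"
  by (simp add: fundamental_group_def loops_at_def)

lemma loop_class_in_carrier [simp]:
  "\<gamma> \<in> loops_at S a \<Longrightarrow> loop_class S \<gamma> \<in> carrier (fundamental_group S a)"
  by (simp add: carrier_fundamental_group)

lemma loops_at_join: "\<gamma> \<in> loops_at S a \<Longrightarrow> \<delta> \<in> loops_at S a \<Longrightarrow> \<gamma> +++ \<delta> \<in> loops_at S a"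
  by (auto simp: loops_at_def path_image_join)

lemma loops_at_reversepath: "\<gamma> \<in> loops_at S a \<Longrightarrow> reversepath \<gamma> \<in> loops_at S a"
  by (auto simp: loops_at_def path_reversepath)

lemma loops_at_const: "a \<in> S \<Longrightarrow> (\<lambda>_. a) \<in> loops_at S a"
  by (auto simp: loops_at_def path_def path_image_def pathstart_def pathfinish_def)

lemma loop_class_member: "\<delta> \<in> loop_class S \<gamma> \<longleftrightarrow> homotopic_paths S \<gamma> \<delta>"
  by (simp add: loop_class_def)

lemma loop_class_self: "\<gamma> \<in> loops_at S a \<Longrightarrow> \<gamma> \<in> loop_class S \<gamma>"
  by (simp add: loop_class_member loops_at_def)

lemma loop_class_mult:
  assumes "\<gamma> \<in> loops_at S a" "\<delta> \<in> loops_at S a"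
  shows "loop_class S \<gamma> \<otimes>\<^bsub>fundamental_group S a\<^esub> loop_class S \<delta> = loop_class S (\<gamma> +++ \<delta>)"
proof -
  have rep: "loop_class S (\<gamma>' +++ \<delta>') = loop_class S (\<gamma> +++ \<delta>)"
    if "\<gamma>' \<in> loop_class S \<gamma>" "\<delta>' \<in> loop_class S \<delta>" for \<gamma>' \<delta>'
  proof (rule HOL.sym, rule loop_class_eq, rule homotopic_paths_join)
    show "pathfinish \<gamma> = pathstart \<delta>" using assms by (simp add: loops_at_def)
  qed (use that in \<open>auto simp: loop_class_member\<close>)
  have ne: "loop_class S \<gamma> \<noteq> {}" "loop_class S \<delta> \<noteq> {}" using assms loop_class_self by blast+
  have "(\<Union>\<gamma>'\<in>loop_class S \<gamma>. \<Union>\<delta>'\<in>loop_class S \<delta>. loop_class S (\<gamma>' +++ \<delta>')) =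
      loop_class S (\<gamma> +++ \<delta>)"
    by (intro UN_eq_constant ne rep)
  then show ?thesis by (simp add: fundamental_group_def)
qed

lemma one_fundamental_group: "\<one>\<^bsub>fundamental_group S a\<^esub> = loop_class S (\<lambda>_. a)"
  by (simp add: fundamental_group_def)

lemma loop_class_inverse:
  assumes "\<gamma> \<in> loops_at S a"
  shows "loop_class S (reversepath \<gamma>) \<otimes>\<^bsub>fundamental_group S a\<^esub> loop_class S \<gamma> = \<one>\<^bsub>fundamental_group S a\<^esub>"
proof -
  have "homotopic_paths S (reversepath \<gamma> +++ \<gamma>) (\<lambda>_. a)"
    using homotopic_reversepath_join[of \<gamma> S] assms by (auto simp: loops_at_def)
  from loop_class_eq[OF this] show ?thesis
    using assms by (simp add: loop_class_mult loops_at_reversepath one_fundamental_group)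
qed

lemma group_fundamental_group:
  assumes "a \<in> S"
  shows "group (fundamental_group S a)"
proof (rule groupI)
  let ?G = "fundamental_group S a"
  show "\<one>\<^bsub>?G\<^esub> \<in> carrier ?G"
    by (simp add: one_fundamental_group loops_at_const[OF assms])
  fix C assume C: "C \<in> carrier ?G"
  then obtain \<gamma> where \<gamma>: "\<gamma> \<in> loops_at S a" "C = loop_class S \<gamma>" by (auto simp: carrier_fundamental_group)
  have "homotopic_paths S ((\<lambda>_. a) +++ \<gamma>) \<gamma>"
    using homotopic_join_const_left[of \<gamma> S] \<gamma> by (auto simp: loops_at_def)
  from loop_class_eq[OF this] show "\<one>\<^bsub>?G\<^esub> \<otimes>\<^bsub>?G\<^esub> C = C"
    using \<gamma> by (simp add: one_fundamental_group loop_class_mult loops_at_const[OF assms])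
  show "\<exists>D\<in>carrier ?G. D \<otimes>\<^bsub>?G\<^esub> C = \<one>\<^bsub>?G\<^esub>"
    using loop_class_inverse[OF \<gamma>(1)] loop_class_in_carrier[OF loops_at_reversepath[OF \<gamma>(1)]] \<gamma>(2) by blast
  fix D assume D: "D \<in> carrier ?G"
  then obtain \<delta> where \<delta>: "\<delta> \<in> loops_at S a" "D = loop_class S \<delta>" by (auto simp: carrier_fundamental_group)
  show "C \<otimes>\<^bsub>?G\<^esub> D \<in> carrier ?G"
    using \<gamma> \<delta> by (simp add: loop_class_mult loops_at_join)
  fix E assume "E \<in> carrier ?G"
  then obtain \<epsilon> where \<epsilon>: "\<epsilon> \<in> loops_at S a" "E = loop_class S \<epsilon>" by (auto simp: carrier_fundamental_group)
  have "homotopic_paths S (\<gamma> +++ (\<delta> +++ \<epsilon>)) ((\<gamma> +++ \<delta>) +++ \<epsilon>)"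
    using \<gamma> \<delta> \<epsilon> by (intro homotopic_paths_assoc) (simp_all add: loops_at_def)
  note assoc = loop_class_eq[OF this]
  show "C \<otimes>\<^bsub>?G\<^esub> D \<otimes>\<^bsub>?G\<^esub> E = C \<otimes>\<^bsub>?G\<^esub> (D \<otimes>\<^bsub>?G\<^esub> E)"
    unfolding \<gamma>(2) \<delta>(2) \<epsilon>(2) loop_class_mult[OF \<gamma>(1) \<delta>(1)] loop_class_mult[OF \<delta>(1) \<epsilon>(1)]
      loop_class_mult[OF loops_at_join[OF \<gamma>(1) \<delta>(1)] \<epsilon>(1)]
      loop_class_mult[OF \<gamma>(1) loops_at_join[OF \<delta>(1) \<epsilon>(1)]]
    by (rule assoc[symmetric])
qed

lemma loops_at_compose:
  assumes "continuous_on S f" "f ` S \<subseteq> T" "\<gamma> \<in> loops_at S a"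
  shows "f \<circ> \<gamma> \<in> loops_at T (f a)"
proof -
  have "path (f \<circ> \<gamma>)"
    using assms by (intro path_continuous_image) (auto simp: loops_at_def intro: continuous_on_subset)
  then show ?thesis
    using assms by (auto simp: loops_at_def path_image_compose pathstart_compose pathfinish_compose)
qed

lemma fundamental_map_loop_class:
  assumes f: "continuous_on S f" "f ` S \<subseteq> T" and \<gamma>: "\<gamma> \<in> loops_at S a"
  shows "fundamental_map T f (loop_class S \<gamma>) = loop_class T (f \<circ> \<gamma>)"
proof -
  have rep: "loop_class T (f \<circ> \<gamma>') = loop_class T (f \<circ> \<gamma>)" if "\<gamma>' \<in> loop_class S \<gamma>" for \<gamma>'
    by (rule HOL.sym, rule loop_class_eq, rule homotopic_paths_continuous_image[of S])
       (use that f in \<open>auto simp: loop_class_member\<close>)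
  show ?thesis
    unfolding fundamental_map_def
    by (rule UN_eq_constant[OF _ rep]) (use loop_class_self[OF \<gamma>] in auto)
qed

lemma fundamental_map_hom:
  assumes f: "continuous_on S f" "f ` S \<subseteq> T"
  shows "fundamental_map T f \<in> hom (fundamental_group S a) (fundamental_group T (f a))"
proof (rule homI)
  fix C assume "C \<in> carrier (fundamental_group S a)"
  then obtain \<gamma> where \<gamma>: "\<gamma> \<in> loops_at S a" "C = loop_class S \<gamma>" by (auto simp: carrier_fundamental_group)
  show "fundamental_map T f C \<in> carrier (fundamental_group T (f a))"
    using \<gamma> loops_at_compose[OF f] by (simp add: fundamental_map_loop_class[OF f])
  fix D assume "D \<in> carrier (fundamental_group S a)"
  then obtain \<delta> where \<delta>: "\<delta> \<in> loops_at S a" "D = loop_class S \<delta>" by (auto simp: carrier_fundamental_group)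
  show "fundamental_map T f (C \<otimes>\<^bsub>fundamental_group S a\<^esub> D) =
      fundamental_map T f C \<otimes>\<^bsub>fundamental_group T (f a)\<^esub> fundamental_map T f D"
    using \<gamma> \<delta> loops_at_compose[OF f \<gamma>(1)] loops_at_compose[OF f \<delta>(1)] fundamental_map_loop_class[OF f loops_at_join[OF \<gamma>(1) \<delta>(1)]]
    by (simp add: loop_class_mult fundamental_map_loop_class[OF f \<gamma>(1)] fundamental_map_loop_class[OF f \<delta>(1)]
        path_compose_join)
qed

section \<open>First homology with coefficients modulo two\<close>

lemma frag_cmul_two_minus: "frag_cmul 2 (- c) = - frag_cmul 2 c"
  using frag_cmul_distrib2[of 2 c "- c"] by (metis add.commute add.right_inverse eq_neg_iff_add_eq_0 frag_cmul_zero2)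

lemma mod2_boundaries_0: "0 \<in> mod2_boundaries n X"
proof -
  have "0 = chain_boundary (Suc n) 0 + frag_cmul 2 0" by simp
  then show ?thesis unfolding mod2_boundaries_def by blast
qed

lemma mod2_boundaries_boundary: "singular_chain (Suc n) X d \<Longrightarrow> chain_boundary (Suc n) d \<in> mod2_boundaries n X"
proof -
  assume "singular_chain (Suc n) X d"
  moreover have "chain_boundary (Suc n) d = chain_boundary (Suc n) d + frag_cmul 2 0" by simp
  ultimately show ?thesis unfolding mod2_boundaries_def by blast
qed

lemma mod2_boundaries_double: "singular_chain n X c \<Longrightarrow> frag_cmul 2 c \<in> mod2_boundaries n X"
proof -
  assume "singular_chain n X c"
  moreover have "frag_cmul 2 c = chain_boundary (Suc n) 0 + frag_cmul 2 c" by simp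
  ultimately show ?thesis unfolding mod2_boundaries_def by (metis (mono_tags, lifting) mem_Collect_eq singular_chain_0)
qed

lemma mod2_boundaries_add:
  assumes "a \<in> mod2_boundaries n X" "b \<in> mod2_boundaries n X"
  shows "a + b \<in> mod2_boundaries n X"
proof -
  obtain d c d' c' where "a = chain_boundary (Suc n) d + frag_cmul 2 c" "b = chain_boundary (Suc n) d' + frag_cmul 2 c'"
    and s: "singular_chain (Suc n) X d" "singular_chain (Suc n) X d'" "singular_chain n X c" "singular_chain n X c'"
    using assms by (auto simp: mod2_boundaries_def)
  then have "a + b = chain_boundary (Suc n) (d + d') + frag_cmul 2 (c + c')"
    by (simp add: chain_boundary_add frag_cmul_distrib2)
  then show ?thesis
    using s unfolding mod2_boundaries_def by (blast intro: singular_chain_add)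
qed

lemma mod2_boundaries_minus:
  assumes "a \<in> mod2_boundaries n X"
  shows "- a \<in> mod2_boundaries n X"
proof -
  obtain d c where "a = chain_boundary (Suc n) d + frag_cmul 2 c"
    and s: "singular_chain (Suc n) X d" "singular_chain n X c"
    using assms by (auto simp: mod2_boundaries_def)
  then have "- a = chain_boundary (Suc n) (- d) + frag_cmul 2 (- c)"
    by (simp only: chain_boundary_minus frag_cmul_two_minus) simp
  then show ?thesis
    using s unfolding mod2_boundaries_def by (blast intro: singular_chain_minus[THEN iffD2])
qed

lemma mod2_boundaries_diff:
  "a \<in> mod2_boundaries n X \<Longrightarrow> b \<in> mod2_boundaries n X \<Longrightarrow> a - b \<in> mod2_boundaries n X"
  using mod2_boundaries_add[of a n X "- b"] mod2_boundaries_minus[of b] by simp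

lemma mod2_cyclesI:
  "\<lbrakk>singular_chain n X c; singular_chain (n - 1) X d; chain_boundary n c = frag_cmul 2 d\<rbrakk>
    \<Longrightarrow> c \<in> mod2_cycles n X"
  by (auto simp: mod2_cycles_def)

lemma mod2_boundaries_subset_cycles: "mod2_boundaries n X \<subseteq> mod2_cycles n X"
proof
  fix a assume "a \<in> mod2_boundaries n X"
  then obtain d c where a: "a = chain_boundary (Suc n) d + frag_cmul 2 c"
    and s: "singular_chain (Suc n) X d" "singular_chain n X c"
    by (auto simp: mod2_boundaries_def)
  have "chain_boundary n a = frag_cmul 2 (chain_boundary n c)"
    unfolding a chain_boundary_add chain_boundary_cmul by (simp add: chain_boundary_boundary_alt[OF s(1)])
  moreover have "singular_chain n X a"
    unfolding a by (intro singular_chain_add singular_chain_boundary_alt singular_chain_cmul s)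
  ultimately show "a \<in> mod2_cycles n X"
    using singular_chain_boundary[OF s(2)] by (auto simp: mod2_cycles_def One_nat_def)
qed

lemma subgroup_mod2_cycles: "subgroup (mod2_cycles n X) (chain_group n X)"
proof
  fix a b assume a: "a \<in> mod2_cycles n X"
  then obtain d where d: "singular_chain n X a" "singular_chain (n - 1) X d" "chain_boundary n a = frag_cmul 2 d"
    by (auto simp: mod2_cycles_def)
  have "chain_boundary n (- a) = frag_cmul 2 (- d)" using d by (simp only: chain_boundary_minus frag_cmul_two_minus)
  then have "- a \<in> mod2_cycles n X"
    by (rule mod2_cyclesI[rotated 2]) (simp_all add: d singular_chain_minus)
  then show "inv\<^bsub>chain_group n X\<^esub> a \<in> mod2_cycles n X"
    using d(1) by (simp add: singular_chain_def)
  assume b: "b \<in> mod2_cycles n X"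
  then obtain d' where d': "singular_chain n X b" "singular_chain (n - 1) X d'" "chain_boundary n b = frag_cmul 2 d'"
    by (auto simp: mod2_cycles_def)
  have "chain_boundary n (a + b) = frag_cmul 2 (d + d')" using d d' by (simp add: chain_boundary_add frag_cmul_distrib2)
  then have "a + b \<in> mod2_cycles n X"
    by (rule mod2_cyclesI[rotated 2]) (simp_all add: d d' singular_chain_add)
  then show "a \<otimes>\<^bsub>chain_group n X\<^esub> b \<in> mod2_cycles n X" by simp
next
  show "\<one>\<^bsub>chain_group n X\<^esub> \<in> mod2_cycles n X"
    using subsetD[OF mod2_boundaries_subset_cycles mod2_boundaries_0] by simp
qed (auto simp: mod2_cycles_def)

lemma carrier_mod2_cycle_group [simp]: "carrier (mod2_cycle_group n X) = mod2_cycles n X"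
  unfolding mod2_cycle_group_def
  by (rule subgroup.carrier_subgroup_generated_subgroup[OF subgroup_mod2_cycles])

lemma mult_mod2_cycle_group [simp]: "monoid.mult (mod2_cycle_group n X) = (+)"
  by (simp add: mod2_cycle_group_def)

lemma one_mod2_cycle_group [simp]: "one (mod2_cycle_group n X) = 0"
  by (simp add: mod2_cycle_group_def)

lemma comm_group_mod2_cycle_group: "comm_group (mod2_cycle_group n X)"
proof -
  interpret comm_group "chain_group n X" by (rule abelian_chain_group)
  show ?thesis unfolding mod2_cycle_group_def by (rule abelian_subgroup_generated) (rule comm_group_axioms)
qed

lemma mod2_cycles_minus:
  assumes "a \<in> mod2_cycles n X" shows "- a \<in> mod2_cycles n X"
proof -
  have "Poly_Mapping.keys a \<subseteq> singular_simplex_set n X"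
    using assms by (simp add: mod2_cycles_def singular_chain_def)
  then show ?thesis using subgroup.m_inv_closed[OF subgroup_mod2_cycles assms] by simp
qed

lemma mod2_cycles_add: "a \<in> mod2_cycles n X \<Longrightarrow> b \<in> mod2_cycles n X \<Longrightarrow> a + b \<in> mod2_cycles n X"
  using subgroup.m_closed[OF subgroup_mod2_cycles, of a n X b] by simp

lemma subgroup_mod2_boundaries: "subgroup (mod2_boundaries n X) (mod2_cycle_group n X)"
proof -
  interpret comm_group "mod2_cycle_group n X" by (rule comm_group_mod2_cycle_group)
  have "inv\<^bsub>mod2_cycle_group n X\<^esub> a = - a" if "a \<in> mod2_boundaries n X" for a
    using that mod2_boundaries_subset_cycles[of n X] mod2_cycles_minus
    by (intro inv_equality) auto
  then show ?thesis
    using mod2_boundaries_subset_cycles[of n X]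
    by unfold_locales (auto simp: mod2_boundaries_add mod2_boundaries_minus mod2_boundaries_0)
qed

definition mod2_class :: "'a::topological_space set \<Rightarrow> 'a chain \<Rightarrow> 'a chain set" where
  "mod2_class S c = mod2_boundaries 1 (top_of_set S) #>\<^bsub>mod2_cycle_group 1 (top_of_set S)\<^esub> c"

abbreviation boundaries1 :: "'a::topological_space set \<Rightarrow> 'a chain set" where
  "boundaries1 S \<equiv> mod2_boundaries 1 (top_of_set S)"

abbreviation cycles1 :: "'a::topological_space set \<Rightarrow> 'a chain set" where
  "cycles1 S \<equiv> mod2_cycles 1 (top_of_set S)"

lemma mod2_class_eq: "mod2_class S c = (\<lambda>b. b + c) ` boundaries1 S"
  by (auto simp: mod2_class_def r_coset_def)

lemma mod2_class_eq_iff: "mod2_class S a = mod2_class S b \<longleftrightarrow> a - b \<in> boundaries1 S"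
proof
  assume "mod2_class S a = mod2_class S b"
  moreover have "a \<in> mod2_class S a"
    unfolding mod2_class_eq using mod2_boundaries_0 by force
  ultimately show "a - b \<in> boundaries1 S" by (auto simp: mod2_class_eq)
next
  assume d: "a - b \<in> boundaries1 S"
  have 1: "c + a \<in> (\<lambda>c. c + b) ` boundaries1 S" if "c \<in> boundaries1 S" for c
    by (rule image_eqI[of _ _ "c + (a - b)"]) (simp_all add: d mod2_boundaries_add that)
  have 2: "c + b \<in> (\<lambda>c. c + a) ` boundaries1 S" if "c \<in> boundaries1 S" for c
    by (rule image_eqI[of _ _ "c - (a - b)"]) (simp_all add: d mod2_boundaries_diff that)
  show "mod2_class S a = mod2_class S b"
    unfolding mod2_class_eq by (intro subset_antisym image_subsetI 1 2)
qed

lemma normal_mod2_boundaries: "mod2_boundaries n X \<lhd> mod2_cycle_group n X"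
  by (rule comm_group.subgroup_imp_normal[OF comm_group_mod2_cycle_group subgroup_mod2_boundaries])

lemma comm_group_H1: "comm_group (H1 S)"
  unfolding mod2_homology_group_def
  by (rule comm_group.abelian_FactGroup[OF comm_group_mod2_cycle_group subgroup_mod2_boundaries])

lemma carrier_H1: "carrier (H1 S) = mod2_class S ` cycles1 S"
  by (simp add: mod2_homology_group_def carrier_FactGroup mod2_class_def)

lemma mod2_class_in_carrier [simp]: "c \<in> cycles1 S \<Longrightarrow> mod2_class S c \<in> carrier (H1 S)"
  by (simp add: carrier_H1)

lemma mod2_class_mult:
  assumes "a \<in> cycles1 S" "b \<in> cycles1 S"
  shows "mod2_class S a \<otimes>\<^bsub>H1 S\<^esub> mod2_class S b = mod2_class S (a + b)"
  using normal.rcos_sum[OF normal_mod2_boundaries[of 1 "top_of_set S"], of a b] assms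
  by (simp add: mod2_homology_group_def mod2_class_def)

lemma one_H1: "\<one>\<^bsub>H1 S\<^esub> = mod2_class S 0"
  by (simp add: mod2_homology_group_def mod2_class_eq)

text \<open>Signs are immaterial modulo two, since \<open>2 b\<close> counts as a boundary.\<close>

lemma mod2_class_diff_eq_add:
  assumes "singular_chain 1 (top_of_set S) b"
  shows "mod2_class S (a - b) = mod2_class S (a + b)"
proof -
  have "(a - b) - (a + b) = - (b + b)" by simp
  also have "b + b = frag_cmul 2 b"
    using frag_cmul_distrib[of 1 1 b] by simp
  finally show ?thesis
    unfolding mod2_class_eq_iff using mod2_boundaries_minus[OF mod2_boundaries_double[OF assms]] by simp
qed

lemma H1_exponent_two:
  assumes "a \<in> carrier (H1 S)"
  shows "a \<otimes>\<^bsub>H1 S\<^esub> a = \<one>\<^bsub>H1 S\<^esub>"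
proof -
  obtain c where c: "c \<in> cycles1 S" "a = mod2_class S c" using assms by (auto simp: carrier_H1)
  then have "singular_chain 1 (top_of_set S) c" by (simp add: mod2_cycles_def)
  from mod2_class_diff_eq_add[OF this, of c] show ?thesis
    by (simp add: c mod2_class_mult one_H1)
qed

text \<open>The point of the standard 1-simplex with barycentric coordinates \<open>(1 - t, t)\<close>, which
  identifies singular 1-simplices with paths.\<close>

definition segment_point :: "real \<Rightarrow> nat \<Rightarrow> real" where
  "segment_point t = (\<lambda>i. if i = 0 then 1 - t else if i = 1 then t else 0)"

lemma segment_point_in_simplex: "t \<in> {0..1} \<Longrightarrow> segment_point t \<in> standard_simplex 1"
  by (auto simp: segment_point_def standard_simplex_def One_nat_def)

lemma simplex_1_segment_point:
  assumes "x \<in> standard_simplex 1"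
  shows "x 1 \<in> {0..1}" "segment_point (x 1) = x"
proof -
  have "{..1} = {0, 1 :: nat}" by auto
  then have "x 0 + x 1 = 1" "\<And>i. i > 1 \<Longrightarrow> x i = 0" "\<And>i. 0 \<le> x i \<and> x i \<le> 1"
    using assms by (auto simp: standard_simplex_def)
  then show "x 1 \<in> {0..1}" "segment_point (x 1) = x"
    by (auto simp: segment_point_def fun_eq_iff algebra_simps)
qed

lemma path_simplex_cong: "(\<And>t. t \<in> {0..1} \<Longrightarrow> \<gamma> t = \<delta> t) \<Longrightarrow> path_simplex \<gamma> = path_simplex \<delta>"
  using simplex_1_segment_point(1) by (auto simp: path_simplex_def fun_eq_iff restrict_def)

lemma singular_simplex_top_of_set:
  "singular_simplex p (top_of_set S) f \<longleftrightarrow>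
    continuous_on (standard_simplex p) f \<and> f ` standard_simplex p \<subseteq> S \<and> f \<in> extensional (standard_simplex p)"
  unfolding singular_simplex_def euclidean_product_topology
  by (auto simp: continuous_map_in_subtopology)

lemma path_simplex_segment_point:
  assumes "\<sigma> \<in> extensional (standard_simplex 1)"
  shows "path_simplex (\<sigma> \<circ> segment_point) = \<sigma>"
proof
  show "path_simplex (\<sigma> \<circ> segment_point) x = \<sigma> x" for x
    using assms simplex_1_segment_point(2)[of x]
    by (cases "x \<in> standard_simplex 1") (simp_all add: path_simplex_def extensional_def)
qed

lemma path_of_simplex:
  assumes "singular_simplex 1 (top_of_set S) \<sigma>"
  shows "path (\<sigma> \<circ> segment_point)" "path_image (\<sigma> \<circ> segment_point) \<subseteq> S"
proof -
  have s: "continuous_on (standard_simplex 1) \<sigma>" "\<sigma> ` standard_simplex 1 \<subseteq> S"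
    using assms by (auto simp: singular_simplex_top_of_set)
  have "continuous_on {0..1} segment_point"
    unfolding segment_point_def
  proof (rule continuous_on_coordinatewise_then_product)
    show "continuous_on {0..1} (\<lambda>t. if i = 0 then 1 - t else if i = 1 then t else 0 :: real)" for i :: nat
      by (cases "i = 0"; cases "i = 1") (auto intro!: continuous_intros)
  qed
  then show "path (\<sigma> \<circ> segment_point)"
    unfolding path_def
    by (rule continuous_on_compose) (rule continuous_on_subset[OF s(1)], use segment_point_in_simplex in auto)
  show "path_image (\<sigma> \<circ> segment_point) \<subseteq> S"
    using s(2) segment_point_in_simplex by (auto simp: path_image_def)
qed

lemma singular_simplex_path_simplex:
  assumes "path \<gamma>" "path_image \<gamma> \<subseteq> S"
  shows "singular_simplex 1 (top_of_set S) (path_simplex \<gamma>)"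
proof -
  have "continuous_on (standard_simplex 1) (\<lambda>x. \<gamma> (x 1))"
    by (rule continuous_on_compose2[of "{0..1}" \<gamma>])
       (use assms simplex_1_segment_point(1) in
         \<open>auto simp: path_def intro: continuous_on_subset[OF continuous_on_product_coordinates]\<close>)
  then show ?thesis
    using assms(2) simplex_1_segment_point(1)
    by (auto simp: singular_simplex_top_of_set path_simplex_def path_image_def cong: continuous_on_cong)
qed

definition edge :: "(real \<Rightarrow> 'a) \<Rightarrow> 'a chain" where
  "edge \<gamma> = frag_of (path_simplex \<gamma>)"

definition vertex :: "'a \<Rightarrow> 'a chain" where
  "vertex v = frag_of (restrict (\<lambda>_. v) (standard_simplex 0))"

lemma singular_chain_edge:
  "path \<gamma> \<Longrightarrow> path_image \<gamma> \<subseteq> S \<Longrightarrow> singular_chain 1 (top_of_set S) (edge \<gamma>)"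
  by (simp add: edge_def singular_chain_of singular_simplex_path_simplex)

lemma chain_boundary_edge: "chain_boundary 1 (edge \<gamma>) = vertex (\<gamma> 1) - vertex (\<gamma> 0)"
proof -
  have f: "simplical_face 0 x \<in> standard_simplex 1" "simplical_face 1 x \<in> standard_simplex 1"
    if "x \<in> standard_simplex 0" for x
    using that simplical_face_in_standard_simplex[of 1 _ x] by auto
  have "singular_face 1 0 (path_simplex \<gamma>) = restrict (\<lambda>_. \<gamma> 1) (standard_simplex 0)"
    "singular_face 1 1 (path_simplex \<gamma>) = restrict (\<lambda>_. \<gamma> 0) (standard_simplex 0)"
    using f by (auto simp: singular_face_def path_simplex_def fun_eq_iff restrict_def simplical_face_def standard_simplex_0)
  then show ?thesis
    by (simp add: edge_def vertex_def chain_boundary_of One_nat_def)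
qed

lemma edge_cycle:
  assumes "path \<gamma>" "path_image \<gamma> \<subseteq> S" "pathstart \<gamma> = pathfinish \<gamma>"
  shows "edge \<gamma> \<in> cycles1 S"
proof -
  have "chain_boundary 1 (edge \<gamma>) = frag_cmul 2 0"
    using assms(3) by (simp add: chain_boundary_edge pathstart_def pathfinish_def)
  then show ?thesis
    using singular_chain_edge[OF assms(1,2)] unfolding mod2_cycles_def by blast
qed

lemma singular_face_2:
  "singular_face 2 k f = path_simplex (f \<circ> simplical_face k \<circ> segment_point)"
proof
  show "singular_face 2 k f x = path_simplex (f \<circ> simplical_face k \<circ> segment_point) x" for x
    using simplex_1_segment_point(2)[of x]
    by (cases "x \<in> standard_simplex 1") (simp_all add: path_simplex_def singular_face_def)
qed

lemma chain_boundary_2: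
  "chain_boundary 2 (frag_of f) =
     edge (f \<circ> simplical_face 0 \<circ> segment_point) - edge (f \<circ> simplical_face 1 \<circ> segment_point)
     + edge (f \<circ> simplical_face 2 \<circ> segment_point)"
  by (simp add: chain_boundary_of numeral_2_eq_2 One_nat_def edge_def singular_face_2[unfolded numeral_2_eq_2])

text \<open>The affine parametrization of the triangle \<open>a b c\<close>, followed by \<open>f\<close>, is a singular
  2-simplex whose faces are the three edge paths. Homotopy invariance and additivity under
  concatenation are instances, with \<open>C\<close> a square and an interval.\<close>

lemma edge_triangle:
  fixes C :: "'c::real_normed_vector set"
  assumes f: "continuous_on C f" "f ` C \<subseteq> S" and "convex C" and abc: "a \<in> C" "b \<in> C" "c \<in> C"
  shows "edge (f \<circ> linepath b c) - edge (f \<circ> linepath a c) + edge (f \<circ> linepath a b) \<in> boundaries1 S"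
proof -
  define h where "h = (\<lambda>x :: nat \<Rightarrow> real. x 0 *\<^sub>R a + x 1 *\<^sub>R b + x 2 *\<^sub>R c)"
  define T where "T = restrict (f \<circ> h) (standard_simplex 2)"
  have hC: "h x \<in> C" if "x \<in> standard_simplex 2" for x
  proof -
    have "x 0 + x 1 + x 2 = 1" "\<And>i. 0 \<le> x i"
      using that by (auto simp: standard_simplex_def numeral_2_eq_2 One_nat_def)
    then have "h x \<in> convex hull {a, b, c}" unfolding h_def convex_hull_3 by blast
    also have "\<dots> \<subseteq> C" using \<open>convex C\<close> abc by (simp add: hull_minimal)
    finally show ?thesis .
  qed
  have "continuous_on (standard_simplex 2) (f \<circ> h)"
  proof (rule continuous_on_compose)
    show "continuous_on (standard_simplex 2) h"
      unfolding h_def by (auto intro!: continuous_intros intro: continuous_on_subset[OF continuous_on_product_coordinates])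
    show "continuous_on (h ` standard_simplex 2) f"
      using hC by (intro continuous_on_subset[OF f(1)]) auto
  qed
  then have "singular_simplex 2 (top_of_set S) T"
    using hC f(2) by (auto simp: singular_simplex_top_of_set T_def cong: continuous_on_cong)
  then have "chain_boundary (Suc 1) (frag_of T) \<in> boundaries1 S"
    by (intro mod2_boundaries_boundary) (simp add: singular_chain_of numeral_2_eq_2)
  moreover have face: "edge (T \<circ> simplical_face k \<circ> segment_point) = edge (f \<circ> l)"
    if "k \<le> 2" "\<And>t. h (simplical_face k (segment_point t)) = l t" for k l
  proof -
    have "T (simplical_face k (segment_point t)) = f (l t)" if "t \<in> {0..1}" for t
      using simplical_face_in_standard_simplex[of 2 k "segment_point t"] segment_point_in_simplex[OF that] \<open>k \<le> 2\<close> that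
      by (simp add: T_def \<open>\<And>t. h (simplical_face k (segment_point t)) = l t\<close>)
    then show ?thesis unfolding edge_def by (auto intro!: arg_cong[of _ _ frag_of] path_simplex_cong)
  qed
  have "edge (T \<circ> simplical_face 0 \<circ> segment_point) = edge (f \<circ> linepath b c)"
    "edge (T \<circ> simplical_face 1 \<circ> segment_point) = edge (f \<circ> linepath a c)"
    "edge (T \<circ> simplical_face 2 \<circ> segment_point) = edge (f \<circ> linepath a b)"
    by (rule face; simp add: h_def simplical_face_def segment_point_def linepath_def)+
  ultimately show ?thesis
    by (simp add: chain_boundary_2[unfolded numeral_2_eq_2] numeral_2_eq_2)
qed

lemma edge_const: "v \<in> S \<Longrightarrow> edge (\<lambda>_. v) \<in> boundaries1 S"
  using edge_triangle[of "UNIV :: real set" "\<lambda>_. v" S 0 0 0] by (simp add: o_def)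

text \<open>Concatenation is a degenerate triangle: take \<open>f = \<gamma> +++ \<delta>\<close> on the unit interval, with vertices
  \<open>0\<close>, \<open>1/2\<close> and \<open>1\<close>.\<close>

lemma edge_join:
  assumes "path \<gamma>" "path_image \<gamma> \<subseteq> S" "path \<delta>" "path_image \<delta> \<subseteq> S" "pathfinish \<gamma> = pathstart \<delta>"
  shows "edge (\<gamma> +++ \<delta>) - (edge \<gamma> + edge \<delta>) \<in> boundaries1 S"
proof -
  let ?f = "\<gamma> +++ \<delta>"
  have f: "continuous_on {0..1} ?f" "?f ` {0..1} \<subseteq> S"
    using assms path_join_imp[of \<gamma> \<delta>] path_image_join[of \<gamma> \<delta>] by (auto simp: path_def path_image_def)
  have "edge (?f \<circ> linepath (1/2) 1) - edge (?f \<circ> linepath 0 1) + edge (?f \<circ> linepath 0 (1/2)) \<in> boundaries1 S"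
    by (rule edge_triangle[OF f]) auto
  moreover have "edge (?f \<circ> linepath 0 (1/2)) = edge \<gamma>"
    unfolding edge_def by (auto intro!: arg_cong[of _ _ frag_of] path_simplex_cong simp: joinpaths_def linepath_def)
  moreover have "edge (?f \<circ> linepath (1/2) 1) = edge \<delta>"
    unfolding edge_def using assms(5)
    by (auto intro!: arg_cong[of _ _ frag_of] path_simplex_cong
        simp: joinpaths_def linepath_def pathfinish_def pathstart_def field_simps)
  ultimately have "edge \<delta> - edge ?f + edge \<gamma> \<in> boundaries1 S" by (simp add: compose_linepath_01)
  from mod2_boundaries_minus[OF this] show ?thesis by (simp add: algebra_simps)
qed

text \<open>The diagonal cuts the domain of the homotopy into two triangles. Both contain the diagonal
  edge, which cancels, and the edges on the two sides that map to endpoints are constant, hence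
  boundaries.\<close>

lemma edge_homotopic:
  assumes "homotopic_paths S \<gamma> \<delta>"
  shows "edge \<gamma> - edge \<delta> \<in> boundaries1 S"
proof -
  obtain h :: "real \<times> real \<Rightarrow> 'a" where h: "continuous_on ({0..1} \<times> {0..1}) h" "h \<in> ({0..1} \<times> {0..1}) \<rightarrow> S"
    "\<forall>x\<in>{0..1}. h (0, x) = \<gamma> x" "\<forall>x\<in>{0..1}. h (1, x) = \<delta> x"
    "\<forall>t\<in>{0..1}. pathstart (h \<circ> Pair t) = pathstart \<gamma> \<and> pathfinish (h \<circ> Pair t) = pathfinish \<gamma>"
    using assms unfolding homotopic_paths by blast
  let ?C = "{0..1} \<times> {0..1} :: (real \<times> real) set"
  note tri = edge_triangle[of ?C h S, OF h(1) _ convex_Times]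
  have hS: "h ` ?C \<subseteq> S" using h(2) by auto
  have e: "edge (h \<circ> linepath p q) = edge \<kappa>" if "\<And>t. t \<in> {0..1} \<Longrightarrow> h (linepath p q t) = \<kappa> t" for p q \<kappa>
    unfolding edge_def using that by (auto intro!: arg_cong[of _ _ frag_of] path_simplex_cong)
  have ends: "h (t, 0) = \<gamma> 0" "h (t, 1) = \<gamma> 1" if "t \<in> {0..1}" for t
    using h(5) that by (auto simp: pathstart_def pathfinish_def)
  have "edge (h \<circ> linepath (0, 1) (1, 1)) - edge (h \<circ> linepath (0, 0) (1, 1)) + edge (h \<circ> linepath (0, 0) (0, 1)) \<in> boundaries1 S"
    by (rule tri[OF hS]) auto
  moreover have "edge (h \<circ> linepath (0, 1) (1, 1)) = edge (\<lambda>_. \<gamma> 1)"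
    by (rule e) (simp add: linepath_def ends)
  moreover have "edge (h \<circ> linepath (0, 0) (0, 1)) = edge \<gamma>"
    by (rule e) (use h(3) in \<open>simp add: linepath_def\<close>)
  ultimately have 1: "edge (\<lambda>_. \<gamma> 1) - edge (h \<circ> linepath (0, 0) (1, 1)) + edge \<gamma> \<in> boundaries1 S" by simp
  have "edge (h \<circ> linepath (1, 0) (1, 1)) - edge (h \<circ> linepath (0, 0) (1, 1)) + edge (h \<circ> linepath (0, 0) (1, 0)) \<in> boundaries1 S"
    by (rule tri[OF hS]) auto
  moreover have "edge (h \<circ> linepath (0, 0) (1, 0)) = edge (\<lambda>_. \<gamma> 0)"
    by (rule e) (simp add: linepath_def ends)
  moreover have "edge (h \<circ> linepath (1, 0) (1, 1)) = edge \<delta>"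
    by (rule e) (use h(4) in \<open>simp add: linepath_def\<close>)
  ultimately have 2: "edge \<delta> - edge (h \<circ> linepath (0, 0) (1, 1)) + edge (\<lambda>_. \<gamma> 0) \<in> boundaries1 S" by simp
  have "\<gamma> 0 \<in> S" "\<gamma> 1 \<in> S" using homotopic_paths_imp_subset[OF assms] by (auto simp: path_image_def)
  then have "edge (\<lambda>_. \<gamma> 0) - edge (\<lambda>_. \<gamma> 1) \<in> boundaries1 S"
    by (intro mod2_boundaries_diff edge_const)
  from mod2_boundaries_add[OF mod2_boundaries_diff[OF 1 2] this] show ?thesis by (simp add: algebra_simps)
qed

text \<open>The converse of \<open>edge_triangle\<close>: the boundary path of a triangle is contractible within it. The
  simplex is parametrized by its last two barycentric coordinates to have a domain in a normed
  space.\<close>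

lemma simplex_2_homotopic:
  assumes "singular_simplex 2 (top_of_set S) T"
  shows "homotopic_paths S ((T \<circ> simplical_face 2 \<circ> segment_point) +++ (T \<circ> simplical_face 0 \<circ> segment_point))
           (T \<circ> simplical_face 1 \<circ> segment_point)"
proof -
  let ?C = "{p :: real \<times> real. 0 \<le> fst p \<and> 0 \<le> snd p \<and> fst p + snd p \<le> 1}"
  define b where "b = (\<lambda>p :: real \<times> real. \<lambda>i::nat. if i = 0 then 1 - fst p - snd p else if i = 1 then fst p else if i = 2 then snd p else 0)"
  have T: "continuous_on (standard_simplex 2) T" "T ` standard_simplex 2 \<subseteq> S"
    using assms by (auto simp: singular_simplex_top_of_set)
  have b: "b p \<in> standard_simplex 2" if "p \<in> ?C" for p
    using that by (auto simp: b_def standard_simplex_def numeral_2_eq_2)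
  have "continuous_on ?C b"
    unfolding b_def
  proof (rule continuous_on_coordinatewise_then_product)
    show "continuous_on ?C (\<lambda>p. if i = 0 then 1 - fst p - snd p else if i = 1 then fst p else if i = 2 then snd p else 0)" for i :: nat
      by (cases "i = 0"; cases "i = 1"; cases "i = 2") (auto intro!: continuous_intros)
  qed
  then have cont: "continuous_on ?C (T \<circ> b)"
    by (rule continuous_on_compose) (rule continuous_on_subset[OF T(1)], use b in auto)
  have img: "(T \<circ> b) ` ?C \<subseteq> S" using b T(2) by auto
  have "convex ?C"
  proof (rule convexI)
    fix p q :: "real \<times> real" and u v :: real
    assume pq: "p \<in> ?C" "q \<in> ?C" and uv: "0 \<le> u" "0 \<le> v" "u + v = 1"
    then have "u * (fst p + snd p) + v * (fst q + snd q) \<le> 1" by (intro convex_bound_le) auto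
    then show "u *\<^sub>R p + v *\<^sub>R q \<in> ?C" using pq uv by (simp add: distrib_left)
  qed
  have f: "T \<circ> simplical_face 0 \<circ> segment_point = (T \<circ> b) \<circ> linepath (1, 0) (0, 1)"
    "T \<circ> simplical_face 1 \<circ> segment_point = (T \<circ> b) \<circ> linepath (0, 0) (0, 1)"
    "T \<circ> simplical_face 2 \<circ> segment_point = (T \<circ> b) \<circ> linepath (0, 0) (1, 0)"
    by (auto simp: fun_eq_iff b_def linepath_def simplical_face_def segment_point_def intro!: arg_cong[of _ _ T])
  have seg: "path_image (linepath p q) \<subseteq> ?C" if "p \<in> ?C" "q \<in> ?C" for p q
    using closed_segment_subset[OF that \<open>convex ?C\<close>] by simp
  have segs: "path_image (linepath (0, 0) (1, 0)) \<subseteq> ?C" "path_image (linepath (1, 0) (0, 1)) \<subseteq> ?C"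
    "path_image (linepath (0, 0) (0, 1)) \<subseteq> ?C"
    by (rule seg; simp)+
  show ?thesis
    unfolding f path_compose_join[symmetric]
    by (rule homotopic_paths_compose_convex[OF cont img \<open>convex ?C\<close>])
       (simp_all only: subset_path_image_join segs path_linepath path_join_imp pathfinish_linepath pathstart_linepath
          pathstart_join pathfinish_join)
qed


section \<open>The Hurewicz theorem modulo two\<close>

lemma hurewicz_loop_class:
  assumes "\<gamma> \<in> loops_at S a"
  shows "hurewicz S (loop_class S \<gamma>) = mod2_class S (edge \<gamma>)"
proof -
  have "(\<lambda>\<gamma>. mod2_class S (edge \<gamma>)) ` loop_class S \<gamma> = {mod2_class S (edge \<gamma>)}"
  proof -
    have "mod2_class S (edge \<delta>) = mod2_class S (edge \<gamma>)" if "\<delta> \<in> loop_class S \<gamma>" for \<delta>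
      unfolding mod2_class_eq_iff
      by (rule edge_homotopic, rule homotopic_paths_sym) (use that in \<open>simp add: loop_class_member\<close>)
    then show ?thesis using loop_class_self[OF assms] by blast
  qed
  then show ?thesis
    by (simp add: hurewicz_def mod2_class_def edge_def)
qed

lemma loop_edge_cycle: "\<gamma> \<in> loops_at S a \<Longrightarrow> edge \<gamma> \<in> cycles1 S"
  by (rule edge_cycle) (auto simp: loops_at_def)

lemma hurewicz_hom: "hurewicz S \<in> hom (fundamental_group S a) (H1 S)"
proof (rule homI)
  fix C assume "C \<in> carrier (fundamental_group S a)"
  then obtain \<gamma> where \<gamma>: "\<gamma> \<in> loops_at S a" "C = loop_class S \<gamma>" by (auto simp: carrier_fundamental_group)
  then show "hurewicz S C \<in> carrier (H1 S)" by (simp add: hurewicz_loop_class loop_edge_cycle)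
  fix D assume "D \<in> carrier (fundamental_group S a)"
  then obtain \<delta> where \<delta>: "\<delta> \<in> loops_at S a" "D = loop_class S \<delta>" by (auto simp: carrier_fundamental_group)
  have "mod2_class S (edge (\<gamma> +++ \<delta>)) = mod2_class S (edge \<gamma> + edge \<delta>)"
    unfolding mod2_class_eq_iff by (rule edge_join) (use \<gamma> \<delta> in \<open>auto simp: loops_at_def\<close>)
  then show "hurewicz S (C \<otimes>\<^bsub>fundamental_group S a\<^esub> D) = hurewicz S C \<otimes>\<^bsub>H1 S\<^esub> hurewicz S D"
    unfolding \<gamma>(2) \<delta>(2) loop_class_mult[OF \<gamma>(1) \<delta>(1)] hurewicz_loop_class[OF \<gamma>(1)] hurewicz_loop_class[OF \<delta>(1)]
      hurewicz_loop_class[OF loops_at_join[OF \<gamma>(1) \<delta>(1)]]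
    by (simp add: mod2_class_mult loop_edge_cycle[OF \<gamma>(1)] loop_edge_cycle[OF \<delta>(1)])
qed
lemma path_system:
  assumes "path_connected S" "y \<in> S"
  obtains \<tau> where "\<And>v. v \<in> S \<Longrightarrow> path (\<tau> v)" "\<And>v. v \<in> S \<Longrightarrow> path_image (\<tau> v) \<subseteq> S"
    "\<And>v. v \<in> S \<Longrightarrow> pathstart (\<tau> v) = y" "\<And>v. v \<in> S \<Longrightarrow> pathfinish (\<tau> v) = v"
proof -
  have "\<forall>v\<in>S. \<exists>t. path t \<and> path_image t \<subseteq> S \<and> pathstart t = y \<and> pathfinish t = v"
    using assms unfolding path_connected_def by blast
  then obtain \<tau> where "\<forall>v\<in>S. path (\<tau> v) \<and> path_image (\<tau> v) \<subseteq> S \<and> pathstart (\<tau> v) = y \<and> pathfinish (\<tau> v) = v"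
    by metis
  then show ?thesis using that by blast
qed

lemma edge_reversepath:
  assumes "path \<gamma>" "path_image \<gamma> \<subseteq> S"
  shows "edge \<gamma> + edge (reversepath \<gamma>) \<in> boundaries1 S"
proof -
  have "pathstart \<gamma> \<in> S" using assms(2) pathstart_in_path_image by blast
  then have 1: "edge (\<lambda>_. pathstart \<gamma>) \<in> boundaries1 S" by (rule edge_const)
  have 2: "edge (\<gamma> +++ reversepath \<gamma>) - (edge \<gamma> + edge (reversepath \<gamma>)) \<in> boundaries1 S"
    by (rule edge_join) (simp_all add: assms path_reversepath)
  have 3: "edge (\<gamma> +++ reversepath \<gamma>) - edge (\<lambda>_. pathstart \<gamma>) \<in> boundaries1 S"
    by (rule edge_homotopic[OF homotopic_join_reversepath[OF assms]])
  from mod2_boundaries_add[OF mod2_boundaries_diff[OF 3 2] 1] show ?thesis by (simp add: algebra_simps)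
qed

text \<open>Choose paths \<open>\<tau> v\<close> from the base point to every point \<open>v\<close>. A 1-simplex from \<open>v\<close> to \<open>w\<close>, minus
  \<open>\<tau> w\<close> plus \<open>\<tau> v\<close>, is homologous to a loop at the base point. By linearity the chain
  \<open>c - cone (\<partial> c)\<close> therefore has a class in the image for every 1-chain \<open>c\<close>, where \<open>cone\<close> extends
  \<open>\<tau>\<close> to 0-chains. For a mod 2 cycle, \<open>\<partial> c\<close> is divisible by two and the correction term
  vanishes modulo two.\<close>

lemma hurewicz_surj:
  assumes S: "path_connected S" and y: "y \<in> S"
  shows "carrier (H1 S) \<subseteq> hurewicz S ` carrier (fundamental_group S y)"
proof
  fix a assume "a \<in> carrier (H1 S)"
  then obtain c where c: "c \<in> cycles1 S" "a = mod2_class S c" by (auto simp: carrier_H1)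
  then obtain d where d: "singular_chain 1 (top_of_set S) c" "singular_chain 0 (top_of_set S) d"
      "chain_boundary 1 c = frag_cmul 2 d"
    by (auto simp: mod2_cycles_def)
  obtain \<tau> where \<tau>: "\<And>v. v \<in> S \<Longrightarrow> path (\<tau> v)" "\<And>v. v \<in> S \<Longrightarrow> path_image (\<tau> v) \<subseteq> S"
    "\<And>v. v \<in> S \<Longrightarrow> pathstart (\<tau> v) = y" "\<And>v. v \<in> S \<Longrightarrow> pathfinish (\<tau> v) = v"
    by (rule path_system[OF S y]) blast
  define cone :: "'a chain \<Rightarrow> 'a chain" where
    "cone = frag_extend (\<lambda>\<sigma>. edge (\<tau> (\<sigma> (\<lambda>j. if j = 0 then 1 else 0))))"
  have cone_vertex: "cone (vertex v) = edge (\<tau> v)" for v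
    by (simp add: cone_def vertex_def)
  have closing: "\<exists>C\<in>carrier (fundamental_group S y).
      c - cone (chain_boundary 1 c) \<in> cycles1 S \<and> mod2_class S (c - cone (chain_boundary 1 c)) = hurewicz S C"
    if "singular_chain 1 (top_of_set S) c" for c
    using that unfolding singular_chain_def
  proof (induction c rule: frag_induction)
    case zero
    have "hurewicz S (loop_class S (\<lambda>_. y)) = mod2_class S 0"
      unfolding hurewicz_loop_class[OF loops_at_const[OF y]] mod2_class_eq_iff using edge_const[OF y] by simp
    then show ?case
      using loops_at_const[OF y] subsetD[OF mod2_boundaries_subset_cycles mod2_boundaries_0]
      by (intro bexI[of _ "loop_class S (\<lambda>_. y)"]) (simp_all add: cone_def)
  next
    case (one \<sigma>)
    then have \<sigma>: "singular_simplex 1 (top_of_set S) \<sigma>" by simp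
    define \<gamma> where "\<gamma> = \<sigma> \<circ> segment_point"
    have \<gamma>: "path \<gamma>" "path_image \<gamma> \<subseteq> S" using path_of_simplex[OF \<sigma>] by (simp_all add: \<gamma>_def)
    have e: "frag_of \<sigma> = edge \<gamma>"
      using path_simplex_segment_point[of \<sigma>] \<sigma> by (simp add: edge_def \<gamma>_def singular_simplex_def)
    have v: "\<gamma> 0 \<in> S" "\<gamma> 1 \<in> S" using \<gamma>(2) by (auto simp: path_image_def)
    have cb: "cone (chain_boundary 1 (edge \<gamma>)) = edge (\<tau> (\<gamma> 1)) - edge (\<tau> (\<gamma> 0))"
      unfolding chain_boundary_edge by (simp add: cone_def frag_extend_diff cone_vertex[unfolded cone_def])
    let ?s = "\<tau> (\<gamma> 0)" and ?t = "\<tau> (\<gamma> 1)"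
    define \<rho> where "\<rho> = ?s +++ (\<gamma> +++ reversepath ?t)"
    have ends: "pathfinish ?s = pathstart \<gamma>" "pathfinish \<gamma> = pathfinish ?t"
      using \<tau>(4) v by (simp_all add: pathstart_def pathfinish_def)
    have r: "path (reversepath ?t)" "path_image (reversepath ?t) \<subseteq> S"
      using \<tau> v by (simp_all add: path_reversepath)
    have gr: "path (\<gamma> +++ reversepath ?t)" "path_image (\<gamma> +++ reversepath ?t) \<subseteq> S"
      using r \<gamma> ends by (simp_all add: subset_path_image_join)
    have \<rho>: "\<rho> \<in> loops_at S y"
      unfolding \<rho>_def loops_at_def using gr \<tau> v ends by (simp add: subset_path_image_join)
    have 1: "edge \<rho> - (edge ?s + edge (\<gamma> +++ reversepath ?t)) \<in> boundaries1 S"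
      unfolding \<rho>_def using gr \<tau> v ends by (intro edge_join) simp_all
    have 2: "edge (\<gamma> +++ reversepath ?t) - (edge \<gamma> + edge (reversepath ?t)) \<in> boundaries1 S"
      using r \<gamma> ends by (intro edge_join) simp_all
    have 3: "edge ?t + edge (reversepath ?t) \<in> boundaries1 S"
      using \<tau> v by (intro edge_reversepath)
    have "edge \<rho> - (edge \<gamma> - (edge ?t - edge ?s)) \<in> boundaries1 S"
      using mod2_boundaries_add[OF mod2_boundaries_add[OF 1 2] 3] by (simp add: algebra_simps)
    then have eq: "mod2_class S (edge \<gamma> - (edge ?t - edge ?s)) = mod2_class S (edge \<rho>)"
      unfolding mod2_class_eq_iff using mod2_boundaries_minus by fastforce
    have "singular_chain 1 (top_of_set S) (edge \<gamma> - (edge ?t - edge ?s))"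
      using \<tau> v \<gamma> by (intro singular_chain_diff singular_chain_edge) simp_all
    moreover have "chain_boundary 1 (edge \<gamma> - (edge ?t - edge ?s)) = frag_cmul 2 0"
      unfolding chain_boundary_diff chain_boundary_edge
      using \<tau>(3,4) v by (simp add: pathstart_def pathfinish_def)
    ultimately have "edge \<gamma> - (edge ?t - edge ?s) \<in> cycles1 S"
      by (intro mod2_cyclesI) simp_all
    then show ?case
      unfolding e cb eq
      by (intro bexI[of _ "loop_class S \<rho>"]) (simp_all add: hurewicz_loop_class[OF \<rho>] \<rho>)
  next
    case (diff a b)
    let ?K = "\<lambda>c. c - cone (chain_boundary 1 c)"
    obtain C D where C: "C \<in> carrier (fundamental_group S y)" "?K a \<in> cycles1 S" "mod2_class S (?K a) = hurewicz S C"
      and D: "D \<in> carrier (fundamental_group S y)" "?K b \<in> cycles1 S" "mod2_class S (?K b) = hurewicz S D"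
      using diff.IH by blast
    have K: "?K (a - b) = ?K a - ?K b"
      by (simp add: cone_def chain_boundary_diff frag_extend_diff)
    have sb: "singular_chain 1 (top_of_set S) (?K b)" using D(2) by (simp add: mod2_cycles_def)
    have cyc: "?K a - ?K b \<in> cycles1 S"
      using mod2_cycles_add[OF C(2) mod2_cycles_minus[OF D(2)]] by (simp only: diff_conv_add_uminus)
    have "mod2_class S (?K a - ?K b) = mod2_class S (?K a) \<otimes>\<^bsub>H1 S\<^esub> mod2_class S (?K b)"
      unfolding mod2_class_diff_eq_add[OF sb] mod2_class_mult[OF C(2) D(2)] ..
    also have "\<dots> = hurewicz S (C \<otimes>\<^bsub>fundamental_group S y\<^esub> D)"
      unfolding C(3) D(3) hom_mult[OF hurewicz_hom C(1) D(1)] ..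
    finally show ?case
      unfolding K using cyc monoid.m_closed[OF group.is_monoid[OF group_fundamental_group[OF y]] C(1) D(1)]
      by blast
  qed
  \<comment> \<open>The correction term is twice the chain \<open>cone d\<close>, where \<open>\<partial> c = 2 d\<close>.\<close>
  have "singular_chain 1 (top_of_set S) (cone d)"
    using d(2) unfolding singular_chain_def
  proof (induction d rule: frag_induction)
    case (one \<sigma>)
    then have "\<sigma> ` standard_simplex 0 \<subseteq> S" by (simp add: singular_simplex_top_of_set)
    then have "\<sigma> (\<lambda>j. if j = 0 then 1 else 0) \<in> S" by (simp add: standard_simplex_0)
    then show ?case
      using singular_chain_edge[of "\<tau> (\<sigma> (\<lambda>j. if j = 0 then 1 else 0))" S] \<tau>
      by (simp add: cone_def flip: singular_chain_def)
  next
    case (diff a b)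
    then show ?case
      by (simp add: cone_def frag_extend_diff singular_chain_diff flip: singular_chain_def)
  qed (simp add: cone_def)
  then have "cone (chain_boundary 1 c) \<in> boundaries1 S"
    unfolding d(3) cone_def frag_extend_cmul by (rule mod2_boundaries_double)
  then have "mod2_class S (c - cone (chain_boundary 1 c)) = mod2_class S c"
    unfolding mod2_class_eq_iff using mod2_boundaries_minus by fastforce
  then show "a \<in> hurewicz S ` carrier (fundamental_group S y)"
    using closing[OF d(1)] c(2) by auto
qed

text \<open>With paths \<open>\<tau> v\<close> from the base point as before, let \<open>w \<gamma>\<close> be the value of \<open>\<phi>\<close> at the loop that
  runs along \<open>\<tau>\<close> to the start of \<open>\<gamma>\<close>, along \<open>\<gamma>\<close>, and back along \<open>\<tau>\<close>. It is homotopy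
  invariant, additive under concatenation, and equal to \<open>\<phi>\<close> on loops. Its linear extension to
  1-chains vanishes on doubles, and on boundaries by \<open>simplex_2_homotopic\<close>, hence descends to
  homology.\<close>

lemma functional_through_hurewicz:
  assumes S: "path_connected S" and y: "y \<in> S" and \<phi>: "\<phi> \<in> hom (fundamental_group S y) Z2"
  obtains \<psi> where "\<psi> \<in> hom (H1 S) Z2"
    "\<And>C. C \<in> carrier (fundamental_group S y) \<Longrightarrow> \<psi> (hurewicz S C) = \<phi> C"
proof -
  obtain \<tau> where \<tau>: "\<And>v. v \<in> S \<Longrightarrow> path (\<tau> v)" "\<And>v. v \<in> S \<Longrightarrow> path_image (\<tau> v) \<subseteq> S"
    "\<And>v. v \<in> S \<Longrightarrow> pathstart (\<tau> v) = y" "\<And>v. v \<in> S \<Longrightarrow> pathfinish (\<tau> v) = v"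
    by (rule path_system[OF S y]) blast
  define closing where "closing = (\<lambda>\<gamma>. \<tau> (pathstart \<gamma>) +++ (\<gamma> +++ reversepath (\<tau> (pathfinish \<gamma>))))"
  define w where "w = (\<lambda>\<gamma>. \<phi> (loop_class S (closing \<gamma>)))"
  have ends: "pathstart \<gamma> \<in> S" "pathfinish \<gamma> \<in> S" if "path_image \<gamma> \<subseteq> S" for \<gamma>
    using that pathstart_in_path_image pathfinish_in_path_image by blast+
  have closing_loop: "closing \<gamma> \<in> loops_at S y" if "path \<gamma>" "path_image \<gamma> \<subseteq> S" for \<gamma>
    unfolding closing_def loops_at_def
    using that \<tau> ends[OF that(2)] by (simp add: subset_path_image_join path_reversepath)
  have w_homotopic: "w \<gamma> = w \<delta>" if "homotopic_paths S \<gamma> \<delta>" for \<gamma> \<delta>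
  proof -
    have "pathstart \<delta> = pathstart \<gamma>" "pathfinish \<delta> = pathfinish \<gamma>"
      using homotopic_paths_imp_pathstart[OF that] homotopic_paths_imp_pathfinish[OF that] by simp_all
    moreover have "path_image \<gamma> \<subseteq> S" using homotopic_paths_imp_subset[OF that] by simp
    ultimately have "homotopic_paths S (closing \<gamma>) (closing \<delta>)"
      unfolding closing_def using \<tau> ends[of \<gamma>] that
      by (simp, intro homotopic_paths_join) (simp_all add: path_reversepath)
    then show ?thesis unfolding w_def by (simp only: loop_class_eq)
  qed
  \<comment> \<open>Between \<open>\<gamma>\<close> and \<open>\<delta>\<close> the product of the two loops runs back and forth along the same \<open>\<tau>\<close>.\<close>
  have w_join: "w (\<gamma> +++ \<delta>) = w \<gamma> + w \<delta>"
    if \<gamma>: "path \<gamma>" "path_image \<gamma> \<subseteq> S" and \<delta>: "path \<delta>" "path_image \<delta> \<subseteq> S" and m: "pathfinish \<gamma> = pathstart \<delta>" for \<gamma> \<delta>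
  proof -
    let ?s = "\<tau> (pathstart \<gamma>)" and ?t = "\<tau> (pathstart \<delta>)" and ?r = "reversepath (\<tau> (pathfinish \<delta>))"
    note e = ends[OF \<gamma>(2)] ends[OF \<delta>(2)]
    note t = \<tau>(1)[OF e(1)] \<tau>(2)[OF e(1)] \<tau>(4)[OF e(1)] \<tau>(1)[OF e(3)] \<tau>(2)[OF e(3)] \<tau>(3)[OF e(3)] \<tau>(4)[OF e(3)]
      \<tau>(1)[OF e(4)] \<tau>(2)[OF e(4)] \<tau>(4)[OF e(4)]
    note simps = t \<gamma> \<delta> m subset_path_image_join path_reversepath
    have "homotopic_paths S (closing \<gamma> +++ closing \<delta>) (?s +++ ((\<gamma> +++ reversepath ?t) +++ closing \<delta>))"
      unfolding closing_def m
      by (rule homotopic_paths_sym, rule homotopic_paths_assoc) (simp_all add: simps)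
    also have "homotopic_paths S \<dots> (?s +++ (\<gamma> +++ (reversepath ?t +++ closing \<delta>)))"
      by (rule homotopic_paths_join, simp add: simps, rule homotopic_paths_sym, rule homotopic_paths_assoc)
         (simp_all add: simps closing_def)
    also have "homotopic_paths S \<dots> (?s +++ (\<gamma> +++ ((reversepath ?t +++ ?t) +++ (\<delta> +++ ?r))))"
      unfolding closing_def
      by (rule homotopic_paths_join, simp add: simps, rule homotopic_paths_join, simp add: simps, rule homotopic_paths_assoc)
         (simp_all add: simps)
    also have "homotopic_paths S \<dots> (?s +++ (\<gamma> +++ ((\<lambda>_. pathfinish ?t) +++ (\<delta> +++ ?r))))"
      by (rule homotopic_paths_join, simp add: simps, rule homotopic_paths_join, simp add: simps, rule homotopic_paths_join,
          rule homotopic_reversepath_join)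
         (simp_all add: simps)
    also have "homotopic_paths S \<dots> (?s +++ (\<gamma> +++ (\<delta> +++ ?r)))"
    proof (rule homotopic_paths_join, simp add: simps, rule homotopic_paths_join, simp add: simps)
      have "homotopic_paths S ((\<lambda>_. pathstart (\<delta> +++ ?r)) +++ (\<delta> +++ ?r)) (\<delta> +++ ?r)"
        by (rule homotopic_join_const_left) (simp_all add: simps)
      then show "homotopic_paths S ((\<lambda>_. pathfinish ?t) +++ (\<delta> +++ ?r)) (\<delta> +++ ?r)"
        by (simp add: simps)
    qed (simp_all add: simps pathstart_def[of "_ +++ _"] joinpaths_def, simp_all add: pathstart_def)
    also have "homotopic_paths S \<dots> (?s +++ ((\<gamma> +++ \<delta>) +++ ?r))"
      by (rule homotopic_paths_join, simp add: simps, rule homotopic_paths_assoc) (simp_all add: simps)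
    also have "?s +++ ((\<gamma> +++ \<delta>) +++ ?r) = closing (\<gamma> +++ \<delta>)"
      by (simp add: closing_def)
    finally have "loop_class S (closing \<gamma> +++ closing \<delta>) = loop_class S (closing (\<gamma> +++ \<delta>))"
      by (rule loop_class_eq)
    moreover have "\<phi> (loop_class S (closing \<gamma> +++ closing \<delta>)) = w \<gamma> + w \<delta>"
      unfolding w_def loop_class_mult[OF closing_loop[OF \<gamma>] closing_loop[OF \<delta>], symmetric]
      by (rule hom_Z2_mult[OF \<phi>]) (intro loop_class_in_carrier closing_loop \<gamma> \<delta>)+
    ultimately show ?thesis by (simp add: w_def)
  qed
  have w_loop: "w \<gamma> = \<phi> (loop_class S \<gamma>)" if \<gamma>: "\<gamma> \<in> loops_at S y" for \<gamma>
  proof -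
    have t: "\<tau> y \<in> loops_at S y" using \<tau> y by (simp add: loops_at_def)
    note r = loops_at_reversepath[OF t]
    have "closing \<gamma> = \<tau> y +++ (\<gamma> +++ reversepath (\<tau> y))"
      using \<gamma> by (simp add: closing_def loops_at_def)
    then have "w \<gamma> = \<phi> (loop_class S (\<tau> y)) + (\<phi> (loop_class S \<gamma>) + \<phi> (loop_class S (reversepath (\<tau> y))))"
      unfolding w_def
      using hom_Z2_mult[OF \<phi> loop_class_in_carrier[OF t] loop_class_in_carrier[OF loops_at_join[OF \<gamma> r]]]
        hom_Z2_mult[OF \<phi> loop_class_in_carrier[OF \<gamma>] loop_class_in_carrier[OF r]]
      by (simp add: loop_class_mult[OF \<gamma> r] loop_class_mult[OF t loops_at_join[OF \<gamma> r]])
    moreover have "\<phi> (loop_class S (reversepath (\<tau> y))) + \<phi> (loop_class S (\<tau> y)) = 0"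
      using hom_Z2_mult[OF \<phi> loop_class_in_carrier[OF r] loop_class_in_carrier[OF t]]
        loop_class_inverse[OF t] hom_Z2_one[OF \<phi> group_fundamental_group[OF y]] by simp
    ultimately show ?thesis by (simp add: ac_simps)
  qed
  interpret Z2: comm_group Z2 by (rule comm_group_Z2)
  obtain \<Phi> where \<Phi>: "\<Phi> \<in> hom (chain_group 1 (top_of_set S)) Z2"
    and \<Phi>_of: "\<And>\<sigma>. singular_simplex 1 (top_of_set S) \<sigma> \<Longrightarrow> \<Phi> (frag_of \<sigma>) = w (\<sigma> \<circ> segment_point)"
    using Z2.free_Abelian_group_universal[of "\<lambda>\<sigma>. w (\<sigma> \<circ> segment_point)" "singular_simplex_set 1 (top_of_set S)"]
    unfolding chain_group_def[symmetric] by auto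
  have \<Phi>_edge: "\<Phi> (edge \<gamma>) = w \<gamma>" if "path \<gamma>" "path_image \<gamma> \<subseteq> S" for \<gamma>
  proof -
    have "homotopic_paths S \<gamma> (path_simplex \<gamma> \<circ> segment_point)"
    proof (rule homotopic_paths_eq[OF that])
      show "\<gamma> t = (path_simplex \<gamma> \<circ> segment_point) t" if "t \<in> {0..1}" for t
        using segment_point_in_simplex[OF that] by (simp add: path_simplex_def) (simp add: segment_point_def)
    qed
    then show ?thesis
      using \<Phi>_of[OF singular_simplex_path_simplex[OF that]] w_homotopic by (simp add: edge_def)
  qed
  have \<Phi>_add: "\<Phi> (a + b) = \<Phi> a + \<Phi> b"
    if "singular_chain 1 (top_of_set S) a" "singular_chain 1 (top_of_set S) b" for a b
    using hom_Z2_mult[OF \<Phi>, of a b] that by simp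
  have \<Phi>_0: "\<Phi> 0 = 0" using hom_Z2_one[OF \<Phi>] by simp
  have \<Phi>_diff: "\<Phi> (a - b) = \<Phi> a + \<Phi> b"
    if "singular_chain 1 (top_of_set S) a" "singular_chain 1 (top_of_set S) b" for a b
    using \<Phi>_add[OF singular_chain_diff[OF that] that(2)] by (cases "\<Phi> b"; cases "\<Phi> (a - b)") auto
  \<comment> \<open>The induction carries along that \<open>c\<close> is a chain in \<open>S\<close>, as needed for the additivity of \<open>\<Phi>\<close>.\<close>
  have \<Phi>_boundary: "singular_chain (Suc 1) (top_of_set S) c \<and> \<Phi> (chain_boundary (Suc 1) c) = 0"
    if "singular_chain (Suc 1) (top_of_set S) c" for c
    using that[unfolded singular_chain_def]
  proof (induction c rule: frag_induction)
    case zero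
    show ?case by (simp add: \<Phi>_0)
  next
    case (one T)
    then have T: "singular_simplex 2 (top_of_set S) T" by (simp add: numeral_2_eq_2 One_nat_def)
    let ?e = "\<lambda>k. T \<circ> simplical_face k \<circ> segment_point"
    note h = simplex_2_homotopic[OF T]
    have p: "path (?e k)" "path_image (?e k) \<subseteq> S" if "k \<le> 2" for k
    proof -
      have "singular_simplex 1 (top_of_set S) (singular_face 2 k T)"
        using singular_simplex_singular_face[OF T _ that] by (simp add: numeral_2_eq_2 One_nat_def)
      from path_of_simplex[OF this] have *: "path (singular_face 2 k T \<circ> segment_point)"
        "path_image (singular_face 2 k T \<circ> segment_point) \<subseteq> S" .
      have eq: "(singular_face 2 k T \<circ> segment_point) t = ?e k t" if "t \<in> {0..1}" for t
        using segment_point_in_simplex[OF that] by (simp add: singular_face_def numeral_2_eq_2 One_nat_def)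
      show "path (?e k)" using *(1) eq unfolding path_def by (rule continuous_on_eq) simp
      have "path_image (?e k) = path_image (singular_face 2 k T \<circ> segment_point)"
        unfolding path_image_def using eq by (intro image_cong) (simp_all only:)
      then show "path_image (?e k) \<subseteq> S" using *(2) by simp
    qed
    have "simplical_face 2 (segment_point 1) = simplical_face 0 (segment_point 0)"
      by (auto simp: simplical_face_def segment_point_def fun_eq_iff)
    then have m: "pathfinish (?e 2) = pathstart (?e 0)" by (simp add: pathfinish_def pathstart_def)
    have "w (?e 2) + w (?e 0) = w (?e 1)"
      using w_join[OF p[of 2] p[of 0] m] w_homotopic[OF h] by simp
    moreover have "\<Phi> (chain_boundary 2 (frag_of T)) = w (?e 0) + w (?e 1) + w (?e 2)"
      unfolding chain_boundary_2
      using p by (simp add: \<Phi>_add \<Phi>_diff \<Phi>_edge singular_chain_edge singular_chain_diff)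
    ultimately have "\<Phi> (chain_boundary (Suc 1) (frag_of T)) = 0"
      by (cases "w (?e 0)"; cases "w (?e 1)"; cases "w (?e 2)") (simp_all add: numeral_2_eq_2 One_nat_def)
    then show ?case using one by (simp add: singular_chain_of)
  next
    case (diff a b)
    have "singular_chain 1 (top_of_set S) (chain_boundary (Suc 1) a)" "singular_chain 1 (top_of_set S) (chain_boundary (Suc 1) b)"
      using diff singular_chain_boundary_alt by blast+
    then show ?case using diff by (simp add: chain_boundary_diff \<Phi>_diff singular_chain_diff)
  qed
  have \<Phi>_kills: "\<Phi> b = 0" if b_boundary: "b \<in> boundaries1 S" for b
  proof -
    obtain d c where b: "b = chain_boundary (Suc 1) d + frag_cmul 2 c"
      and s: "singular_chain (Suc 1) (top_of_set S) d" "singular_chain 1 (top_of_set S) c"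
      using b_boundary unfolding mod2_boundaries_def by blast
    have "frag_cmul 2 c = c + c" using frag_cmul_distrib[of 1 1 c] by simp
    then show ?thesis
      using s singular_chain_boundary_alt[OF s(1)] \<Phi>_boundary[OF s(1)]
      by (simp add: b \<Phi>_add singular_chain_add)
  qed
  have \<Phi>_hom: "\<Phi> \<in> hom (mod2_cycle_group 1 (top_of_set S)) Z2"
    by (rule homI) (auto simp: mod2_cycles_def \<Phi>_add)
  obtain \<psi> where \<psi>: "\<psi> \<in> hom (H1 S) Z2" "\<And>c. c \<in> cycles1 S \<Longrightarrow> \<psi> (mod2_class S c) = \<Phi> c"
  proof (rule FactGroup_universal[OF \<Phi>_hom normal_mod2_boundaries])
    fix a b assume ab: "a \<in> carrier (mod2_cycle_group 1 (top_of_set S))" "b \<in> carrier (mod2_cycle_group 1 (top_of_set S))"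
      "boundaries1 S #>\<^bsub>mod2_cycle_group 1 (top_of_set S)\<^esub> a = boundaries1 S #>\<^bsub>mod2_cycle_group 1 (top_of_set S)\<^esub> b"
    then have "a - b \<in> boundaries1 S" by (simp add: mod2_class_eq_iff flip: mod2_class_def)
    then have "\<Phi> (a - b) = 0" by (rule \<Phi>_kills)
    then show "\<Phi> a = \<Phi> b"
      using \<Phi>_diff[of a b] ab(1,2) by (cases "\<Phi> a"; cases "\<Phi> b") (simp_all add: mod2_cycles_def)
  qed (auto simp: mod2_homology_group_def mod2_class_def intro: that)
  show ?thesis
  proof (rule that[OF \<psi>(1)])
    fix C assume "C \<in> carrier (fundamental_group S y)"
    then obtain \<gamma> where \<gamma>: "\<gamma> \<in> loops_at S y" "C = loop_class S \<gamma>" by (auto simp: carrier_fundamental_group)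
    then have "path \<gamma>" "path_image \<gamma> \<subseteq> S" by (auto simp: loops_at_def)
    then show "\<psi> (hurewicz S C) = \<phi> C"
      using \<gamma> by (simp add: hurewicz_loop_class \<psi>(2) loop_edge_cycle \<Phi>_edge w_loop)
  qed
qed

text \<open>Uniqueness in the definite description is the surjectivity of the Hurewicz map.\<close>

lemma homology_functional_hom:
  assumes S: "path_connected S" and y: "y \<in> S" and \<phi>: "\<phi> \<in> hom (fundamental_group S y) Z2"
  shows "homology_functional S y \<phi> \<in> hom (H1 S) Z2"
    and "C \<in> carrier (fundamental_group S y) \<Longrightarrow> homology_functional S y \<phi> (hurewicz S C) = \<phi> C"
proof -
  let ?P = "\<lambda>\<psi>. \<psi> \<in> hom (H1 S) Z2 \<and> \<psi> \<in> extensional (carrier (H1 S)) \<and>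
    (\<forall>C\<in>carrier (fundamental_group S y). \<psi> (hurewicz S C) = \<phi> C)"
  obtain \<psi> where \<psi>: "\<psi> \<in> hom (H1 S) Z2"
    "\<And>C. C \<in> carrier (fundamental_group S y) \<Longrightarrow> \<psi> (hurewicz S C) = \<phi> C"
    by (rule functional_through_hurewicz[OF assms]) blast
  have "restrict \<psi> (carrier (H1 S)) \<in> hom (H1 S) Z2"
    using \<psi>(1) comm_group_H1[of S] by (auto simp: hom_def comm_group_def comm_monoid_def monoid.m_closed)
  moreover have "hurewicz S C \<in> carrier (H1 S)" if "C \<in> carrier (fundamental_group S y)" for C
    using hurewicz_hom[of S y] that by (auto simp: hom_def)
  ultimately have ex: "?P (restrict \<psi> (carrier (H1 S)))" using \<psi>(2) by auto
  have "?P (homology_functional S y \<phi>)"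
    unfolding homology_functional_def
  proof (rule theI[of ?P, OF ex])
    fix \<eta> assume \<eta>: "?P \<eta>"
    show "\<eta> = restrict \<psi> (carrier (H1 S))"
    proof (rule extensionalityI[of _ "carrier (H1 S)"])
      fix a assume "a \<in> carrier (H1 S)"
      then obtain C where "C \<in> carrier (fundamental_group S y)" "a = hurewicz S C"
        using hurewicz_surj[OF S y] by blast
      then show "\<eta> a = restrict \<psi> (carrier (H1 S)) a" using \<eta> ex by simp
    qed (use \<eta> in auto)
  qed
  then show "homology_functional S y \<phi> \<in> hom (H1 S) Z2"
    "C \<in> carrier (fundamental_group S y) \<Longrightarrow> homology_functional S y \<phi> (hurewicz S C) = \<phi> C" by auto
qed

section \<open>Quadratic sections\<close>

text \<open>The algebraic situation of the theorem, with \<open>V\<close> and \<open>W\<close> the first homology of base and total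
  space and \<open>\<nu> 0\<close> the class of the fiber. The assumptions \<open>separated\<close> and \<open>detected\<close> provide the
  functionals that prove \<open>\<nu> 0, \<dots>, \<nu> (2 g)\<close> linearly independent.\<close>

locale quadratic_extension = symplectic_space V g \<sigma> d + W: comm_group W
  for V :: "('v, 'm) monoid_scheme" (structure) and g \<sigma> d and W :: "('w, 'n) monoid_scheme" +
  fixes \<nu> :: "nat \<Rightarrow> 'w" and r :: "nat \<Rightarrow> bit" and s :: "'v \<Rightarrow> 'w"
  assumes W_exponent_two: "w \<in> carrier W \<Longrightarrow> w \<otimes>\<^bsub>W\<^esub> w = \<one>\<^bsub>W\<^esub>"
    and \<nu>_closed: "i \<in> {0..2 * g} \<Longrightarrow> \<nu> i \<in> carrier W"
    and \<nu>_generates: "generate W (\<nu> ` {0..2 * g}) = carrier W"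
    and quadratic: "quadratic_section V W g d \<sigma> \<nu> r s"
    and separated: "c \<in> carrier V \<Longrightarrow>
      \<exists>\<eta>\<in>hom W Z2. \<eta> (\<nu> 0) = 0 \<and> (\<forall>i\<in>{1..2 * g}. \<eta> (\<nu> i) = d (\<sigma> i) c)"
    and detected: "\<exists>\<eta>\<in>hom W Z2. \<eta> (\<nu> 0) = 1"
begin

text \<open>These points are the coordinates on \<open>W\<close>: it is the set of pairs \<open>(a, t)\<close> with addition
  twisted by the cocycle \<open>d\<close>.\<close>

definition point :: "'v \<Rightarrow> bit \<Rightarrow> 'w" where
  "point a t = s a \<otimes>\<^bsub>W\<^esub> scale W t (\<nu> 0)"

lemma \<nu>0_closed [simp]: "\<nu> 0 \<in> carrier W"
  using \<nu>_closed by simp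

lemma scale_W_closed [simp]: "scale W t (\<nu> 0) \<in> carrier W"
  by (simp add: scale_def)

lemma scale_W_add: "scale W (t + t') (\<nu> 0) = scale W t (\<nu> 0) \<otimes>\<^bsub>W\<^esub> scale W t' (\<nu> 0)"
  by (cases t; cases t') (simp_all add: scale_def W_exponent_two)

lemma s_closed [simp]: "a \<in> carrier V \<Longrightarrow> s a \<in> carrier W"
  using quadratic by (auto simp: quadratic_section_def)

lemma s_basis: "i \<in> {1..2 * g} \<Longrightarrow> s (\<sigma> i) = \<nu> i \<otimes>\<^bsub>W\<^esub> scale W (r i) (\<nu> 0)"
  using quadratic by (auto simp: quadratic_section_def)

lemma s_mult:
  "a \<in> carrier V \<Longrightarrow> b \<in> carrier V \<Longrightarrow> s (a \<otimes> b) = s a \<otimes>\<^bsub>W\<^esub> s b \<otimes>\<^bsub>W\<^esub> scale W (d a b) (\<nu> 0)"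
  using quadratic by (auto simp: quadratic_section_def)

lemma s_one: "s \<one> = \<one>\<^bsub>W\<^esub>"
  using s_mult[of \<one> \<one>] by (simp add: scale_def W_exponent_two)

lemma point_closed [simp]: "a \<in> carrier V \<Longrightarrow> point a t \<in> carrier W"
  by (simp add: point_def)

lemma point_zero: "a \<in> carrier V \<Longrightarrow> point a 0 = s a"
  by (simp add: point_def scale_def)

lemma point_one: "point \<one> t = scale W t (\<nu> 0)"
  by (simp add: point_def s_one)

lemma point_mult:
  assumes "a \<in> carrier V" "b \<in> carrier V"
  shows "point a t \<otimes>\<^bsub>W\<^esub> point b t' = point (a \<otimes> b) (t + t' + d a b)"
proof -
  have c: "scale W (d a b) (\<nu> 0) \<otimes>\<^bsub>W\<^esub> (scale W (d a b) (\<nu> 0) \<otimes>\<^bsub>W\<^esub> w) = w" if "w \<in> carrier W" for w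
    using that by (simp add: W_exponent_two flip: W.m_assoc)
  show ?thesis
    using assms by (simp add: point_def s_mult scale_W_add W.m_ac c W_exponent_two)
qed

lemma \<nu>_eq_point: "i \<in> {1..2 * g} \<Longrightarrow> \<nu> i = point (\<sigma> i) (r i)"
  using \<nu>_closed[of i] by (simp add: point_def s_basis W.m_assoc W_exponent_two)

lemma self_inverse: "w \<in> carrier W \<Longrightarrow> inv\<^bsub>W\<^esub> w = w"
  by (intro W.inv_equality W_exponent_two)

lemma exists_point:
  assumes "w \<in> carrier W"
  obtains a t where "a \<in> carrier V" "w = point a t"
proof -
  have base: "\<exists>a\<in>carrier V. \<exists>t. \<nu> i = point a t" if "i \<in> {0..2 * g}" for i
  proof (cases "i = 0")
    case True
    then have "\<nu> i = point \<one> 1" by (simp add: point_one scale_def)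
    then show ?thesis by blast
  next
    case False
    then have i: "i \<in> {1..2 * g}" using that by auto
    show ?thesis using \<nu>_eq_point[OF i] basis_closed[OF i] by blast
  qed
  have "w \<in> generate W (\<nu> ` {0..2 * g})" using assms \<nu>_generates by simp
  then have "\<exists>a\<in>carrier V. \<exists>t. w = point a t"
  proof (induction rule: generate.induct)
    case one
    have "\<one>\<^bsub>W\<^esub> = point \<one> 0" by (simp add: point_zero s_one)
    then show ?case by blast
  next
    case (incl h)
    then show ?case using base by auto
  next
    case (inv h)
    then obtain i where i: "i \<in> {0..2 * g}" "h = \<nu> i" by blast
    then show ?case using base[OF i(1)] self_inverse[OF \<nu>_closed[OF i(1)]] by simp
  next
    case (eng h1 h2)
    then obtain a t b t' where "a \<in> carrier V" "h1 = point a t" "b \<in> carrier V" "h2 = point b t'" by blast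
    then show ?case using point_mult[of a b t t'] m_closed[of a b] by auto
  qed
  then show ?thesis using that by blast
qed

lemma hom_point:
  assumes \<eta>: "\<eta> \<in> hom W Z2" and a: "a \<in> carrier V"
  shows "\<eta> (point a t) = \<eta> (s a) + t * \<eta> (\<nu> 0)"
  using hom_Z2_mult[OF \<eta>, of "s a" "scale W t (\<nu> 0)"] hom_Z2_one[OF \<eta> W.is_group] a
  by (cases t) (simp_all add: point_def scale_def)

lemma hom_s_mult:
  assumes \<eta>: "\<eta> \<in> hom W Z2" and "a \<in> carrier V" "b \<in> carrier V"
  shows "\<eta> (s (a \<otimes> b)) = \<eta> (s a) + \<eta> (s b) + d a b * \<eta> (\<nu> 0)"
proof -
  have "s (a \<otimes> b) = s a \<otimes>\<^bsub>W\<^esub> point b (d a b)"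
    using assms by (simp add: s_mult point_def W.m_assoc)
  then show ?thesis
    using assms by (simp add: hom_Z2_mult[OF \<eta>] hom_point ac_simps)
qed

text \<open>The functional that belongs to \<open>c\<close> maps \<open>point a t\<close> to \<open>d a c\<close>, so the point determines \<open>a\<close> by
  nondegeneracy; a functional with value \<open>1\<close> at \<open>\<nu> 0\<close> then determines \<open>t\<close>.\<close>

lemma point_inj:
  assumes a: "a \<in> carrier V" and b: "b \<in> carrier V" and eq: "point a t = point b t'"
  shows "a = b \<and> t = t'"
proof -
  have "d c (a \<otimes> b) = 0" if c: "c \<in> carrier V" for c
  proof -
    obtain \<eta> where \<eta>: "\<eta> \<in> hom W Z2" "\<eta> (\<nu> 0) = 0" "\<forall>i\<in>{1..2 * g}. \<eta> (\<nu> i) = d (\<sigma> i) c"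
      using separated[OF c] by blast
    have sd: "\<eta> (s a) = d a c" if "a \<in> carrier V" for a
    proof (rule additive_eqI[OF _ _ _ that])
      show "\<eta> (s (\<sigma> i)) = d (\<sigma> i) c" if "i \<in> {1..2 * g}" for i
        using bspec[OF \<eta>(3) that] hom_point[OF \<eta>(1), of "\<sigma> i" "r i"] basis_closed[OF that] \<nu>_eq_point[OF that] \<eta>(2) by simp
    qed (simp_all add: hom_s_mult[OF \<eta>(1)] \<eta>(2) d_add_left c)
    have "\<eta> (point a t) = \<eta> (point b t')" by (simp only: eq)
    then have "d a c = d b c"
      using a b by (simp add: hom_point[OF \<eta>(1)] \<eta>(2) sd)
    then show ?thesis using a b c by (simp add: d_add_right d_sym[of c])
  qed
  then have "a \<otimes> b = \<one>" using a b by (intro nondegenerate) auto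
  then have ab: "a = b" using inv_equality[OF _ b a] inv_equality[OF exponent_two[OF b] b b] by simp
  obtain \<eta> where \<eta>: "\<eta> \<in> hom W Z2" "\<eta> (\<nu> 0) = 1" using detected by blast
  have "\<eta> (point a t) = \<eta> (point b t')" by (simp only: eq)
  then have "t = t'" using a ab by (simp add: hom_point[OF \<eta>(1)] \<eta>(2))
  with ab show ?thesis by simp
qed

text \<open>The map \<open>point a t \<mapsto> point (f a) t\<close> is a homomorphism because \<open>f\<close> preserves the cocycle \<open>d\<close>. It
  is the lift, since any two candidates agree on the generators \<open>\<nu> i\<close>.\<close>

lemma section_lift_point:
  assumes f: "f \<in> symplectic_auts V d" and a: "a \<in> carrier V"
  shows "section_lift W g \<sigma> (\<nu> 0) s f (point a t) = point (f a) t"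
proof -
  have f_iso: "f \<in> hom V V" "bij_betw f (carrier V) (carrier V)"
    and f_d: "\<And>a b. a \<in> carrier V \<Longrightarrow> b \<in> carrier V \<Longrightarrow> d (f a) (f b) = d a b"
    using f by (auto simp: symplectic_auts_def iso_def)
  have f_cl: "f a \<in> carrier V" if "a \<in> carrier V" for a
    using hom_in_carrier[OF f_iso(1) that] .
  define k where "k = restrict (\<lambda>w. THE w'. \<exists>a\<in>carrier V. \<exists>t. w = point a t \<and> w' = point (f a) t) (carrier W)"
  have k: "k (point a t) = point (f a) t" if "a \<in> carrier V" for a t
    unfolding k_def using that by (auto intro!: the_equality dest: point_inj)
  have k_hom: "k \<in> hom W W"
  proof (rule homI)
    fix w assume "w \<in> carrier W"
    then obtain a t where a: "a \<in> carrier V" "w = point a t" by (rule exists_point)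
    then show "k w \<in> carrier W" by (simp add: k f_cl)
    fix w' assume "w' \<in> carrier W"
    then obtain b t' where b: "b \<in> carrier V" "w' = point b t'" by (rule exists_point)
    show "k (w \<otimes>\<^bsub>W\<^esub> w') = k w \<otimes>\<^bsub>W\<^esub> k w'"
      unfolding a(2) b(2) using a(1) b(1)
      by (simp add: point_mult k f_cl f_d hom_mult[OF f_iso(1)])
  qed
  have "inj_on k (carrier W)"
  proof (rule inj_onI)
    fix w w' assume w: "w \<in> carrier W" "w' \<in> carrier W" and eq: "k w = k w'"
    obtain a t where a: "a \<in> carrier V" "w = point a t" using w(1) by (rule exists_point)
    obtain b t' where b: "b \<in> carrier V" "w' = point b t'" using w(2) by (rule exists_point)
    have "f a = f b \<and> t = t'"
      using eq a b by (intro point_inj) (simp_all add: k f_cl)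
    then have "a = b" "t = t'" using a(1) b(1) f_iso(2) by (auto simp: bij_betw_def inj_on_def)
    then show "w = w'" using a(2) b(2) by simp
  qed
  moreover have "k ` carrier W = carrier W"
  proof
    show "carrier W \<subseteq> k ` carrier W"
    proof
      fix w assume "w \<in> carrier W"
      then obtain a t where a: "a \<in> carrier V" "w = point a t" by (rule exists_point)
      then obtain b where "b \<in> carrier V" "a = f b" using f_iso(2) by (auto simp: bij_betw_def)
      then show "w \<in> k ` carrier W" using a k[of b t] by (intro image_eqI[of _ _ "point b t"]) simp_all
    qed
  qed (use k_hom in \<open>auto simp: hom_def\<close>)
  ultimately have k_iso: "k \<in> iso W W" using k_hom by (simp add: iso_def bij_betw_def)
  have k_basis: "k (s (\<sigma> i)) = s (f (\<sigma> i))" if "i \<in> {1..2 * g}" for i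
    using k[of "\<sigma> i" 0] basis_closed[OF that] by (simp add: point_zero f_cl)
  have f_one: "f \<one> = \<one>" using hom_one[OF f_iso(1) is_group is_group] .
  have k_\<nu>0: "k (\<nu> 0) = \<nu> 0"
    using k[of \<one> 1] by (simp add: point_one f_one scale_def)
  have "section_lift W g \<sigma> (\<nu> 0) s f = k"
    unfolding section_lift_def
  proof (rule the_equality)
    fix l assume l: "l \<in> iso W W \<and> l \<in> extensional (carrier W) \<and>
      (\<forall>i\<in>{1..2 * g}. l (s (\<sigma> i)) = s (f (\<sigma> i))) \<and> l (\<nu> 0) = \<nu> 0"
    then have l_hom: "l \<in> hom W W" by (simp add: iso_def)
    have one: "l \<one>\<^bsub>W\<^esub> = k \<one>\<^bsub>W\<^esub>" using hom_one[OF l_hom] hom_one[OF k_hom] W.is_group by simp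
    have gen: "l (\<nu> i) = k (\<nu> i)" if "i \<in> {0..2 * g}" for i
    proof (cases "i = 0")
      case False
      then have i: "i \<in> {1..2 * g}" using that by auto
      have "l (scale W (r i) (\<nu> 0)) = k (scale W (r i) (\<nu> 0))"
        using l k_\<nu>0 one by (cases "r i") (simp_all add: scale_def)
      then show ?thesis
        unfolding \<nu>_eq_point[OF i] point_def
        using l k_basis[OF i] i basis_closed[OF i] by (simp add: hom_mult[OF l_hom] hom_mult[OF k_hom])
    qed (use l k_\<nu>0 in simp)
    have "l w = k w" if "w \<in> generate W (\<nu> ` {0..2 * g})" for w
      using that
    proof (induction rule: generate.induct)
      case (inv h)
      then obtain i where i: "i \<in> {0..2 * g}" "h = \<nu> i" by blast
      then show ?case using gen[OF i(1)] self_inverse[OF \<nu>_closed[OF i(1)]] by simp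
    next
      case (eng h1 h2)
      then show ?case using \<nu>_generates by (simp add: hom_mult[OF l_hom] hom_mult[OF k_hom])
    qed (use one gen in auto)
    then have "\<And>w. w \<in> carrier W \<Longrightarrow> l w = k w" by (simp add: \<nu>_generates)
    moreover have "k \<in> extensional (carrier W)" by (simp add: k_def)
    ultimately show "l = k" using l by (intro extensionalityI[of l "carrier W" k]) auto
  qed (use k_iso k_basis k_\<nu>0 in \<open>auto simp: k_def\<close>)
  then show ?thesis using k[OF a] by simp
qed

text \<open>In the coordinates \<open>point a t\<close> both functionals add \<open>t\<close> to their value at \<open>s a\<close>, so equality of
  \<open>\<psi>\<close> and the pulled back \<open>\<psi>'\<close> reduces to an equality of quadratic forms on \<open>V\<close>.\<close>

theorem s_related_iff_arf:
  assumes \<psi>: "\<psi> \<in> hom W Z2" "\<psi> (\<nu> 0) = 1" and \<psi>': "\<psi>' \<in> hom W Z2" "\<psi>' (\<nu> 0) = 1"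
  shows "s_related V W g d \<sigma> (\<nu> 0) s \<psi> \<psi>' \<longleftrightarrow>
    arf_invariant g \<sigma> (\<psi> \<circ> s) = arf_invariant g \<sigma> (\<psi>' \<circ> s)"
proof -
  have form: "quadratic_form (\<eta> \<circ> s)" if "\<eta> \<in> hom W Z2" "\<eta> (\<nu> 0) = 1" for \<eta>
    unfolding quadratic_form_def using that by (simp add: hom_s_mult)
  have "(\<forall>w\<in>carrier W. \<psi> w = \<psi>' (section_lift W g \<sigma> (\<nu> 0) s f w)) \<longleftrightarrow>
      (\<forall>a\<in>carrier V. (\<psi> \<circ> s) a = (\<psi>' \<circ> s) (f a))" (is "?L \<longleftrightarrow> ?R")
    if f: "f \<in> symplectic_auts V d" for f
  proof
    have f_cl: "f a \<in> carrier V" if "a \<in> carrier V" for a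
      using f that by (auto simp: symplectic_auts_def iso_def hom_def)
    show ?R if ?L
    proof
      fix a assume a: "a \<in> carrier V"
      then show "(\<psi> \<circ> s) a = (\<psi>' \<circ> s) (f a)"
        using bspec[OF that, of "point a 0"] section_lift_point[OF f a, of 0] f_cl[OF a] by (simp add: point_zero)
    qed
    show ?L if ?R
    proof
      fix w assume "w \<in> carrier W"
      then obtain a t where a: "a \<in> carrier V" "w = point a t" by (rule exists_point)
      then show "\<psi> w = \<psi>' (section_lift W g \<sigma> (\<nu> 0) s f w)"
        using that f_cl[OF a(1)] by (simp add: section_lift_point[OF f] hom_point[OF \<psi>(1)] hom_point[OF \<psi>'(1)] \<psi>(2) \<psi>'(2))
    qed
  qed
  then show ?thesis
    unfolding s_related_def quadratic_forms_equivalent_iff_arf[OF form[OF \<psi>] form[OF \<psi>'], symmetric] by auto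
qed

end

section \<open>Circle bundles over surfaces\<close>

lemma oriented_surface_path_connected:
  assumes "oriented_surface g F e"
  shows "e ` cball 0 1 = F" "path_connected F"
proof -
  have q: "quotient_map (top_of_set (cball 0 1)) (top_of_set F) e"
    using assms by (simp add: oriented_surface_def)
  show F: "e ` cball 0 1 = F" using quotient_imp_surjective_map[OF q] by simp
  have "continuous_on (cball 0 1) e"
    using quotient_imp_continuous_map[OF q] by (simp add: continuous_map_in_subtopology)
  from path_connected_continuous_image[OF this convex_imp_path_connected[OF convex_cball]]
  show "path_connected F" by (simp add: F)
qed

lemma principal_circle_bundleD:
  assumes "principal_circle_bundle act P p F"
  shows "continuous_on (unit_circle \<times> P) (\<lambda>(z, y). act z y)"
    and "z \<in> unit_circle \<Longrightarrow> y \<in> P \<Longrightarrow> act z y \<in> P"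
    and "y \<in> P \<Longrightarrow> act 1 y = y"
    and "continuous_on P p" "p ` P = F"
  using assms unfolding principal_circle_bundle_def by simp_all

text \<open>Inside one trivialization, the fibers are the orbits of the circle.\<close>

lemma principal_circle_bundle_fibre:
  assumes "principal_circle_bundle act P p F" and "y \<in> P"
  shows "w \<in> unit_circle \<Longrightarrow> p (act w y) = p y"
    and "\<lbrakk>y' \<in> P; p y' = p y\<rbrakk> \<Longrightarrow> \<exists>w\<in>unit_circle. y' = act w y"
proof -
  have "p y \<in> F" using principal_circle_bundleD(5)[OF assms(1)] assms(2) by blast
  have "\<forall>x\<in>F. \<exists>U \<psi> \<psi>'.
        openin (top_of_set F) U \<and> x \<in> U \<and>
        homeomorphism (U \<times> unit_circle) {y \<in> P. p y \<in> U} \<psi> \<psi>' \<and>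
        (\<forall>x'\<in>U. \<forall>z\<in>unit_circle.
           p (\<psi> (x', z)) = x' \<and> (\<forall>w\<in>unit_circle. act w (\<psi> (x', z)) = \<psi> (x', w * z)))"
    using assms(1) unfolding principal_circle_bundle_def by (elim conjE) assumption
  from bspec[OF this \<open>p y \<in> F\<close>] obtain U \<psi> \<psi>' where U: "p y \<in> U" "homeomorphism (U \<times> unit_circle) {y \<in> P. p y \<in> U} \<psi> \<psi>'"
    and triv: "\<forall>x'\<in>U. \<forall>z\<in>unit_circle.
           p (\<psi> (x', z)) = x' \<and> (\<forall>w\<in>unit_circle. act w (\<psi> (x', z)) = \<psi> (x', w * z))"
    by (elim exE conjE) (rule that)
  have \<psi>: "\<And>x' z. x' \<in> U \<Longrightarrow> z \<in> unit_circle \<Longrightarrow> p (\<psi> (x', z)) = x'"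
      "\<And>x' z w. x' \<in> U \<Longrightarrow> z \<in> unit_circle \<Longrightarrow> w \<in> unit_circle \<Longrightarrow> act w (\<psi> (x', z)) = \<psi> (x', w * z)"
    using triv by blast+
  have chart: "\<exists>z\<in>unit_circle. y' = \<psi> (p y, z)" if y': "y' \<in> P" "p y' = p y" for y'
  proof -
    have "y' \<in> \<psi> ` (U \<times> unit_circle)" using U y' by (simp add: homeomorphism_def)
    then obtain x z where "x \<in> U" "z \<in> unit_circle" "y' = \<psi> (x, z)" by auto
    then show ?thesis using \<psi>(1) y'(2) by metis
  qed
  obtain z where z: "z \<in> unit_circle" "y = \<psi> (p y, z)" using chart[OF assms(2)] by blast
  show "p (act w y) = p y" if w: "w \<in> unit_circle"
  proof -
    have "act w y = \<psi> (p y, w * z)" using \<psi>(2)[OF U(1) z(1) w] z(2) by simp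
    moreover have "w * z \<in> unit_circle" using w z(1) by (simp add: norm_mult)
    ultimately show ?thesis using \<psi>(1)[OF U(1)] by simp
  qed
  show "\<exists>w\<in>unit_circle. y' = act w y" if y': "y' \<in> P" "p y' = p y"
  proof -
    obtain z' where z': "z' \<in> unit_circle" "y' = \<psi> (p y, z')" using chart[OF y'] by blast
    have w: "z' / z \<in> unit_circle" "z' / z * z = z'" using z z' by (auto simp: norm_divide)
    have "act (z' / z) y = y'" using \<psi>(2)[OF U(1) z(1) w(1)] z(2) z'(2) w(2) by simp
    then show ?thesis using w(1) by metis
  qed
qed

text \<open>The lift \<open>\<tau>\<close> of the 2-cell contained in the definition of the Chern number meets every fiber,
  so moving it by the circle action sweeps out all of \<open>P\<close>: a product of a circle and a disc
  maps onto \<open>P\<close>.\<close>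

lemma total_space_path_connected:
  assumes F: "oriented_surface g F e" and P: "principal_circle_bundle act P p F" and "chern_number act P p e q"
  shows "path_connected P"
proof -
  obtain \<tau> where \<tau>: "continuous_on (cball 0 1) \<tau>" "\<tau> ` cball 0 1 \<subseteq> P" "\<forall>z\<in>cball 0 1. p (\<tau> z) = e z"
    using assms(3) unfolding chern_number_def by (elim exE conjE) (rule that)
  note act = principal_circle_bundleD(1,2)[OF P]
  let ?h = "\<lambda>(w, z). act w (\<tau> z)"
  have lift: "continuous_on (unit_circle \<times> cball 0 1) (\<lambda>x. (fst x, \<tau> (snd x)))"
    by (intro continuous_on_Pair continuous_on_fst continuous_on_id continuous_on_compose2[OF \<tau>(1)] continuous_on_snd) auto
  have lift_in: "(\<lambda>x. (fst x, \<tau> (snd x))) ` (unit_circle \<times> cball 0 1) \<subseteq> unit_circle \<times> P"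
    using \<tau>(2) by (simp add: image_subset_iff)
  have "continuous_on (unit_circle \<times> cball 0 1) ?h"
    using continuous_on_compose2[OF act(1) lift lift_in] by (simp add: case_prod_unfold)
  moreover have "path_connected (unit_circle \<times> cball (0::complex) 1)"
    by (intro path_connected_Times path_connected_sphere convex_imp_path_connected) auto
  ultimately have "path_connected (?h ` (unit_circle \<times> cball 0 1))"
    by (rule path_connected_continuous_image)
  moreover have "?h ` (unit_circle \<times> cball 0 1) = P"
  proof (intro subset_antisym subsetI)
    fix y assume y: "y \<in> P"
    then have "p y \<in> F" using principal_circle_bundleD(5)[OF P] by blast
    then obtain z where z: "z \<in> cball 0 1" "p y = e z"
      using oriented_surface_path_connected(1)[OF F] by blast
    have "\<tau> z \<in> P" "p y = p (\<tau> z)" using \<tau>(2,3) z by auto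
    then obtain w where "w \<in> unit_circle" "y = act w (\<tau> z)"
      using principal_circle_bundle_fibre(2)[OF P _ y] by blast
    then show "y \<in> ?h ` (unit_circle \<times> cball 0 1)" using z(1) by (intro image_eqI[of _ _ "(w, z)"]) auto
  qed (use act(2) \<tau>(2) in auto)
  ultimately show ?thesis by simp
qed

text \<open>The class is represented by an orbit of the circle action, and \<open>p\<close> is constant on orbits.\<close>

lemma fiber_class_projection:
  assumes P: "principal_circle_bundle act P p F" and y: "y \<in> P" and C: "fiber_class act P y C"
  shows "C \<in> carrier (fundamental_group P y)"
    and "fundamental_map F p C = \<one>\<^bsub>fundamental_group F (p y)\<^esub>"
proof -
  obtain \<zeta> where \<zeta>: "\<zeta> \<in> loops_at unit_circle 1"
    and C': "C = fundamental_map P (\<lambda>w. act w y) (loop_class unit_circle \<zeta>)"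
    using C by (auto simp: fiber_class_def carrier_fundamental_group)
  have pc: "continuous_on P p" "p ` P \<subseteq> F" using principal_circle_bundleD(4,5)[OF P] by simp_all
  note act = principal_circle_bundleD(1)[OF P] principal_circle_bundleD(2)[OF P _ y] principal_circle_bundleD(3)[OF P y]
  have "continuous_on unit_circle (\<lambda>w. (w, y))" by (intro continuous_intros)
  from continuous_on_compose2[OF act(1) this] have orbit: "continuous_on unit_circle (\<lambda>w. act w y)" "(\<lambda>w. act w y) ` unit_circle \<subseteq> P"
    using y act(2) by auto
  let ?\<gamma> = "(\<lambda>w. act w y) \<circ> \<zeta>"
  have \<gamma>: "?\<gamma> \<in> loops_at P y" using loops_at_compose[OF orbit \<zeta>] act(3) by simp
  have C_eq: "C = loop_class P ?\<gamma>" unfolding C' by (rule fundamental_map_loop_class[OF orbit \<zeta>])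
  show "C \<in> carrier (fundamental_group P y)" unfolding C_eq using \<gamma> by simp
  have p\<gamma>: "p \<circ> ?\<gamma> \<in> loops_at F (p y)" by (rule loops_at_compose[OF pc \<gamma>])
  have "homotopic_paths F (p \<circ> ?\<gamma>) (\<lambda>_. p y)"
  proof (rule homotopic_paths_eq)
    fix t :: real assume "t \<in> {0..1}"
    then have "\<zeta> t \<in> path_image \<zeta>" by (auto simp: path_image_def)
    then have "\<zeta> t \<in> unit_circle" using \<zeta> by (auto simp: loops_at_def)
    then show "(p \<circ> ?\<gamma>) t = p y" using principal_circle_bundle_fibre(1)[OF P y] by simp
  qed (use p\<gamma> in \<open>auto simp: loops_at_def\<close>)
  then show "fundamental_map F p C = \<one>\<^bsub>fundamental_group F (p y)\<^esub>"
    unfolding C_eq fundamental_map_loop_class[OF pc \<gamma>] one_fundamental_group by (rule loop_class_eq)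
qed

lemma hom_image_generates:
  assumes "group G" "group H" "h \<in> hom G H" "S \<subseteq> carrier G" "generate G S = carrier G" "carrier H \<subseteq> h ` carrier G"
  shows "generate H (h ` S) = carrier H"
proof -
  interpret group_hom G H h using assms by (simp add: group_hom_def group_hom_axioms_def)
  show ?thesis using generate_img[OF assms(4)] assms(5,6) by auto
qed

theorem theorem15:
  fixes g :: nat and q :: int
    and F :: "'b::topological_space set" and e :: "complex \<Rightarrow> 'b"
    and P :: "'a::topological_space set" and p :: "'a \<Rightarrow> 'b" and act :: "complex \<Rightarrow> 'a \<Rightarrow> 'a"
    and y :: 'a
    and x :: "nat \<Rightarrow> (real \<Rightarrow> 'b) set" and u :: "nat \<Rightarrow> (real \<Rightarrow> 'a) set"
    and \<sigma> :: "nat \<Rightarrow> 'b chain set" and \<nu> :: "nat \<Rightarrow> 'a chain set"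
    and d :: "'b chain set \<Rightarrow> 'b chain set \<Rightarrow> bit"
    and r :: "nat \<Rightarrow> bit" and s :: "'b chain set \<Rightarrow> 'a chain set"
    and \<phi> \<phi>' :: "(real \<Rightarrow> 'a) set \<Rightarrow> bit"
    and \<psi> \<psi>' :: "'a chain set \<Rightarrow> bit"
  assumes "1 \<le> g"
    and "oriented_surface g F e"
    and "principal_circle_bundle act P p F"
    and "chern_number act P p e q" and "even q"
    and "y \<in> P"
    and "presented_by (fundamental_group F (p y)) {1..2 * g} x (surface_relators g)"
    and "fiber_class act P y (u 0)"
    and "\<forall>i\<in>{1..2 * g}. u i \<in> carrier (fundamental_group P y) \<and> fundamental_map F p (u i) = x i"
    and "presented_by (fundamental_group P y) {0..2 * g} u (bundle_relators g q)"
    and "\<sigma> = (\<lambda>i. hurewicz F (x i))"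
    and "\<nu> = (\<lambda>i. hurewicz P (u i))"
    and "intersection_product (H1 F) g \<sigma> d"
    and "quadratic_section (H1 F) (H1 P) g d \<sigma> \<nu> r s"
    and "\<phi> \<in> special_coverings P y (u 0)" and "\<phi>' \<in> special_coverings P y (u 0)"
    and "\<psi> = homology_functional P y \<phi>" and "\<psi>' = homology_functional P y \<phi>'"
  shows "s_related (H1 F) (H1 P) g d \<sigma> (\<nu> 0) s \<psi> \<psi>'
    \<longleftrightarrow> arf_invariant g \<sigma> (\<psi> \<circ> s) = arf_invariant g \<sigma> (\<psi>' \<circ> s)"
proof -
  note surface = assms(2) and fibration = assms(3) and y = \<open>y \<in> P\<close>
  let ?\<pi>P = "fundamental_group P y" and ?\<pi>F = "fundamental_group F (p y)"
  have p: "continuous_on P p" "p ` P \<subseteq> F" and py: "p y \<in> F"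
    using principal_circle_bundleD(4,5)[OF fibration] y by auto
  have F: "path_connected F" by (rule oriented_surface_path_connected(2)[OF surface])
  have P: "path_connected P" by (rule total_space_path_connected[OF surface fibration assms(4)])
  have groups: "group ?\<pi>P" "group ?\<pi>F" "group (H1 P)" "group (H1 F)"
    using group_fundamental_group y py comm_group_H1 comm_group.axioms(2) by blast+
  have x: "x ` {1..2 * g} \<subseteq> carrier ?\<pi>F" "generate ?\<pi>F (x ` {1..2 * g}) = carrier ?\<pi>F"
    using assms(7) by (auto simp: presented_by_def)
  have u: "u ` {0..2 * g} \<subseteq> carrier ?\<pi>P" "generate ?\<pi>P (u ` {0..2 * g}) = carrier ?\<pi>P"
    using assms(10) by (auto simp: presented_by_def)
  have \<sigma>_image: "\<sigma> ` A = hurewicz F ` x ` A" and \<nu>_image: "\<nu> ` A = hurewicz P ` u ` A" for A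
    by (simp_all add: assms(11,12) image_image)
  have V: "symplectic_space (H1 F) g \<sigma> d"
  proof (intro symplectic_space.intro symplectic_space_axioms.intro comm_group_H1)
    show "\<sigma> i \<in> carrier (H1 F)" if "i \<in> {1..2 * g}" for i
      using hom_in_carrier[OF hurewicz_hom[of F "p y"], of "x i"] x(1) that by (simp add: assms(11) image_subset_iff)
    show "generate (H1 F) (\<sigma> ` {1..2 * g}) = carrier (H1 F)"
      unfolding \<sigma>_image
      by (rule hom_image_generates[OF groups(2,4) hurewicz_hom x hurewicz_surj[OF F py]])
  qed (use assms(13) H1_exponent_two in auto)
  interpret V: symplectic_space "H1 F" g \<sigma> d by (rule V)
  have \<psi>_hom: "homology_functional P y \<theta> \<in> hom (H1 P) Z2" "homology_functional P y \<theta> (\<nu> 0) = \<theta> (u 0)"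
    if "\<theta> \<in> hom ?\<pi>P Z2" for \<theta>
    using homology_functional_hom[OF P y that] fiber_class_projection(1)[OF fibration y assms(8)]
    by (simp_all add: assms(12))
  have special: "\<phi> \<in> hom ?\<pi>P Z2" "\<phi> (u 0) = 1" "\<phi>' \<in> hom ?\<pi>P Z2" "\<phi>' (u 0) = 1"
    using assms(15,16) by (auto simp: special_coverings_def)
  have "quadratic_extension (H1 F) g \<sigma> d (H1 P) \<nu> r s"
  proof (intro quadratic_extension.intro quadratic_extension_axioms.intro V comm_group_H1)
    show "\<nu> i \<in> carrier (H1 P)" if "i \<in> {0..2 * g}" for i
      using hom_in_carrier[OF hurewicz_hom[of P y], of "u i"] u(1) that by (simp add: assms(12) image_subset_iff)
    show "generate (H1 P) (\<nu> ` {0..2 * g}) = carrier (H1 P)"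
      unfolding \<nu>_image
      by (rule hom_image_generates[OF groups(1,3) hurewicz_hom u hurewicz_surj[OF P y]])
    show "\<exists>\<eta>\<in>hom (H1 P) Z2. \<eta> (\<nu> 0) = 1"
      using \<psi>_hom[OF special(1)] special(2) by auto
    fix c assume c: "c \<in> carrier (H1 F)"
    \<comment> \<open>The functional attached to \<open>c\<close> starts on the fundamental group: project to the base and pair with \<open>c\<close>.\<close>
    define \<theta> where "\<theta> = (\<lambda>C. d (hurewicz F (fundamental_map F p C)) c)"
    have hur: "hurewicz F \<circ> fundamental_map F p \<in> hom ?\<pi>P (H1 F)"
      by (rule hom_compose[OF fundamental_map_hom[OF p] hurewicz_hom])
    have \<theta>: "\<theta> \<in> hom ?\<pi>P Z2"
      using hom_in_carrier[OF hur] hom_mult[OF hur] c by (intro homI) (simp_all add: \<theta>_def V.d_add_left)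
    have "\<theta> (u 0) = 0"
      using hom_one[OF hurewicz_hom groups(2,4)] c
      by (simp add: \<theta>_def fiber_class_projection(2)[OF fibration y assms(8)])
    moreover have "\<theta> (u i) = d (\<sigma> i) c" if "i \<in> {1..2 * g}" for i
      using assms(9) that by (simp add: \<theta>_def assms(11))
    ultimately show "\<exists>\<eta>\<in>hom (H1 P) Z2. \<eta> (\<nu> 0) = 0 \<and> (\<forall>i\<in>{1..2 * g}. \<eta> (\<nu> i) = d (\<sigma> i) c)"
      using \<psi>_hom[OF \<theta>] homology_functional_hom(2)[OF P y \<theta>] assms(9) by (auto simp: assms(12))
  qed (use assms(14) H1_exponent_two in auto)
  then show ?thesis
    using \<psi>_hom[OF special(1)] \<psi>_hom[OF special(3)] special(2,4) assms(17,18)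
    by (intro quadratic_extension.s_related_iff_arf) auto
qed

end
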